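(* Let $A\in M_n(\mathbb{F})$ be a 2-regular nilpotent matrix. Then the variety $N_2(A)$ is irreducible.
   Context: $\mathbb{F}$ is an algebraically closed field of arbitrary characteristic. A matrix in $M_n(\mathbb{F})$ is called $r$-regular if each of its eigenspaces is at most $r$-dimensional; so a nilpotent matrix is $r$-regular if and only if its Jordan canonical form has at most $r$ Jordan blocks. For a nilpotent $A\in M_n(\mathbb{F})$, $N_2(A)=\{(B,C)\in M_n(\mathbb{F})^2 : B, C \text{ nilpotent},\ AB=BA,\ AC=CA,\ BC=CB\}$, a Zariski closed subset of the affine space $M_n(\mathbb{F})^2$. Irreducibility is with respect to the Zariski topology. *)

theory Defs
  imports
    "HOL-Analysis.Abstract_Topology"
    "Jordan_Normal_Form.Matrix_Kernel"
    "Jordan_Normal_Form.Char_Poly"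
begin

section \<open>The Zariski topology\<close>

text \<open>The algebra of polynomial functions in the coordinate functions \<open>X\<close>. Using functions
  instead of formal polynomials is harmless: a zero locus only depends on the values.\<close>

inductive_set poly_fun :: "('p \<Rightarrow> 'a::comm_ring_1) set \<Rightarrow> ('p \<Rightarrow> 'a) set"
  for X :: "('p \<Rightarrow> 'a) set"
  where
    const: "(\<lambda>_. c) \<in> poly_fun X"
  | coord: "x \<in> X \<Longrightarrow> x \<in> poly_fun X"
  | add: "f \<in> poly_fun X \<Longrightarrow> g \<in> poly_fun X \<Longrightarrow> (\<lambda>p. f p + g p) \<in> poly_fun X"
  | mult: "f \<in> poly_fun X \<Longrightarrow> g \<in> poly_fun X \<Longrightarrow> (\<lambda>p. f p * g p) \<in> poly_fun X"

definition zero_locus :: "'p set \<Rightarrow> ('p \<Rightarrow> 'a::comm_ring_1) set \<Rightarrow> 'p set" where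
  "zero_locus P F = {p \<in> P. \<forall>f\<in>F. f p = 0}"

definition zariski :: "'p set \<Rightarrow> ('p \<Rightarrow> 'a::idom) set \<Rightarrow> 'p topology" where
  "zariski P X = topology (\<lambda>U. \<exists>F \<subseteq> poly_fun X. U = P - zero_locus P F)"

lemma istopology_zariski:
  fixes X :: "('p \<Rightarrow> 'a::idom) set"
  shows "istopology (\<lambda>U. \<exists>F \<subseteq> poly_fun X. U = P - zero_locus P F)"
  unfolding istopology_def
proof (intro conjI allI impI)
  fix S T
  assume "\<exists>F \<subseteq> poly_fun X. S = P - zero_locus P F" "\<exists>F \<subseteq> poly_fun X. T = P - zero_locus P F"
  then obtain F G where F: "F \<subseteq> poly_fun X" "S = P - zero_locus P F"
    and G: "G \<subseteq> poly_fun X" "T = P - zero_locus P G"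
    by blast
  define H where "H = {\<lambda>p. f p * g p | f g. f \<in> F \<and> g \<in> G}"
  have "H \<subseteq> poly_fun X"
    using F(1) G(1) unfolding H_def by (auto intro: poly_fun.mult)
  moreover have "S \<inter> T = P - zero_locus P H"
  proof (rule Set.set_eqI)
    fix p
    have "(\<exists>h\<in>H. h p \<noteq> 0) \<longleftrightarrow> (\<exists>f\<in>F. f p \<noteq> 0) \<and> (\<exists>g\<in>G. g p \<noteq> 0)"
      by (auto simp: H_def Bex_def) (metis no_zero_divisors)
    then have "p \<in> zero_locus P H \<longleftrightarrow> p \<in> zero_locus P F \<or> p \<in> zero_locus P G"
      unfolding zero_locus_def mem_Collect_eq by blast
    then show "p \<in> S \<inter> T \<longleftrightarrow> p \<in> P - zero_locus P H"
      by (simp only: F(2) G(2) Int_iff Diff_iff) blast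
  qed
  ultimately show "\<exists>F \<subseteq> poly_fun X. S \<inter> T = P - zero_locus P F"
    by blast
next
  fix \<K>
  assume "\<forall>K\<in>\<K>. \<exists>F \<subseteq> poly_fun X. K = P - zero_locus P F"
  then obtain F where F: "\<And>K. K \<in> \<K> \<Longrightarrow> F K \<subseteq> poly_fun X"
    and K: "\<And>K. K \<in> \<K> \<Longrightarrow> K = P - zero_locus P (F K)"
    by metis
  have "(\<Union>K\<in>\<K>. F K) \<subseteq> poly_fun X"
    using F by blast
  moreover have "\<Union>\<K> = P - zero_locus P (\<Union>K\<in>\<K>. F K)"
  proof -
    have "(\<Union>K\<in>\<K>. K) = (\<Union>K\<in>\<K>. P - zero_locus P (F K))"
      by (rule SUP_cong[OF refl K])
    also have "\<dots> = P - zero_locus P (\<Union>K\<in>\<K>. F K)"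
      unfolding zero_locus_def by blast
    finally show ?thesis
      by simp
  qed
  ultimately show "\<exists>F \<subseteq> poly_fun X. \<Union>\<K> = P - zero_locus P F"
    by (intro exI conjI)
qed

lemma openin_zariski:
  "openin (zariski P X) U \<longleftrightarrow> (\<exists>F \<subseteq> poly_fun X. U = P - zero_locus P F)"
  by (simp only: zariski_def topology_inverse'[OF istopology_zariski])

lemma topspace_zariski [simp]: "topspace (zariski P X) = P"
proof -
  have "P = P - zero_locus P {\<lambda>_. 1}"
    by (auto simp: zero_locus_def)
  then have "openin (zariski P X) P"
    unfolding openin_zariski by (metis empty_subsetI insert_subset poly_fun.const)
  then show ?thesis
    unfolding topspace_def openin_zariski by blast
qed

lemma closedin_zariski:
  "closedin (zariski P X) Z \<longleftrightarrow> (\<exists>F \<subseteq> poly_fun X. Z = zero_locus P F)"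
proof -
  have "zero_locus P F \<subseteq> P" for F :: "('a \<Rightarrow> 'b) set"
    by (auto simp: zero_locus_def)
  then show ?thesis
    unfolding closedin_def topspace_zariski openin_zariski by (metis Diff_subset double_diff subset_refl)
qed

definition irreducible_space :: "'p topology \<Rightarrow> bool" where
  "irreducible_space T \<longleftrightarrow> topspace T \<noteq> {} \<and>
     (\<forall>C D. closedin T C \<and> closedin T D \<and> C \<union> D = topspace T
        \<longrightarrow> C = topspace T \<or> D = topspace T)"


section \<open>Pairs of matrices\<close>

definition mat_pair_coords :: "nat \<Rightarrow> ('a mat \<times> 'a mat \<Rightarrow> 'a) set" where
  "mat_pair_coords n =
     {\<lambda>(B, C). B $$ (i, j) | i j. i < n \<and> j < n} \<union> {\<lambda>(B, C). C $$ (i, j) | i j. i < n \<and> j < n}"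

definition zariski_mat_pair :: "nat \<Rightarrow> ('a::idom mat \<times> 'a mat) topology" where
  "zariski_mat_pair n = zariski (carrier_mat n n \<times> carrier_mat n n) (mat_pair_coords n)"

text \<open>\<open>A\<close> is meant to be square.\<close>

definition nilpotent_mat :: "'a::semiring_1 mat \<Rightarrow> bool" where
  "nilpotent_mat A \<longleftrightarrow> (\<exists>k. A ^\<^sub>m k = 0\<^sub>m (dim_row A) (dim_row A))"

text \<open>Since \<open>char_matrix A c\<close> is \<open>A - c I\<close>, its kernel is the eigenspace of \<open>A\<close> for \<open>c\<close>,
  which is the zero space if \<open>c\<close> is not an eigenvalue.\<close>

definition regular_mat :: "nat \<Rightarrow> 'a::field mat \<Rightarrow> bool" where
  "regular_mat r A \<longleftrightarrow> (\<forall>c. kernel_dim (char_matrix A c) \<le> r)"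

definition N2 :: "nat \<Rightarrow> 'a::semiring_1 mat \<Rightarrow> ('a mat \<times> 'a mat) set" where
  "N2 n A = {(B, C). B \<in> carrier_mat n n \<and> C \<in> carrier_mat n n \<and>
     nilpotent_mat B \<and> nilpotent_mat C \<and> A * B = B * A \<and> A * C = C * A \<and> B * C = C * B}"

end

theory Submission
  imports Defs
begin

text \<open>
  As a module over \<open>R = \<F>[t]\<close>, with \<open>t\<close> acting as \<open>A\<close>, the space \<open>\<F>\<^sup>n\<close> is \<open>R/(t\<^sup>a) \<oplus> R/(t\<^sup>b)\<close> with
  \<open>a = b + d\<close>. An endomorphism is a matrix with rows \<open>(p, t\<^sup>d q)\<close> and \<open>(r, s)\<close>; up to polynomials in \<open>A\<close> it is the
  vector \<open>u = (p - s, q, r)\<close> over \<open>R/(t\<^sup>b)\<close>, and two endomorphisms commute iff the \<open>2 \<times> 2\<close> minors of their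
  vectors vanish modulo \<open>t\<^sup>b\<close>. If some entry of \<open>u\<close> is a unit, then every vector parallel to \<open>u\<close> is a multiple
  of \<open>u\<close>, so the second matrix is \<open>c(A) B + e(A)\<close>. The pairs \<open>(B, c(A) B + e(A))\<close> with \<open>B\<close> nilpotent are pairwise
  joined by polynomial curves inside \<open>N\<^sub>2(A)\<close>, so it suffices that they are dense. For an arbitrary pair
  \<open>(B, C)\<close> write \<open>C - c(A) B = A\<^sup>j V + e(A)\<close> with \<open>j\<close> maximal. If \<open>V\<close> can be chosen nilpotent, then
  \<open>(B + x V, C + x c(A) V)\<close> is a line through \<open>(B, C)\<close> which lies in the dense family for almost all \<open>x\<close>. Whether it
  can is decided by a discriminant, which is quadratic along the pencil spanned by the leading
  coefficients of \<open>C - c(A) B\<close> and \<open>B\<close>; so, after possibly exchanging \<open>B\<close> and \<open>C\<close>, a root provides such a \<open>V\<close>.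
\<close>

section \<open>Irreducibility through polynomial curves\<close>

text \<open>Over a finite field, one plus the product of all \<open>X - a\<close> takes the value 1
  everywhere, so it has no root although its degree is positive.\<close>

lemma infinite_UNIV_alg_closed_field: "infinite (UNIV :: 'a::alg_closed_field set)"
proof
  assume fin: "finite (UNIV :: 'a set)"
  define p where "p = (\<Prod>a\<in>(UNIV :: 'a set). [:- a, 1:]) + 1"
  have val: "poly p x = 1" for x
    unfolding p_def using fin by (auto simp: poly_prod)
  have "degree (\<Prod>a\<in>(UNIV :: 'a set). [:- a, 1:]) = card (UNIV :: 'a set)"
    by (subst degree_prod_eq_sum_degree) (auto simp: one_pCons)
  moreover have "card (UNIV :: 'a set) > 0"
    using fin by (simp add: card_gt_0_iff)
  ultimately have "degree p > 0"
    unfolding p_def by (subst degree_add_eq_left) auto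
  then obtain x where "poly p x = 0"
    using alg_closed_imp_poly_has_root by blast
  then show False
    using val by simp
qed

lemma finite_nonroots_imp_common:
  fixes p q :: "'a::alg_closed_field poly"
  assumes "p \<noteq> 0" "q \<noteq> 0" "finite S"
  obtains x where "x \<notin> S" "poly p x \<noteq> 0" "poly q x \<noteq> 0"
proof -
  have "finite (S \<union> {x. poly p x = 0} \<union> {x. poly q x = 0})"
    using assms poly_roots_finite by blast
  then obtain x where "x \<notin> S \<union> {x. poly p x = 0} \<union> {x. poly q x = 0}"
    using ex_new_if_finite[OF infinite_UNIV_alg_closed_field] by metis
  then show ?thesis
    using that by blast
qed

text \<open>For each of two proper closed subsets some defining function is nonzero somewhere on
  \<open>S\<close>. A common point of nonvanishing for these functions lies in neither subset, so
  the two cannot cover \<open>S\<close>.\<close>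

lemma irreducible_space_zariskiI:
  fixes X :: "('p \<Rightarrow> 'a::idom) set"
  assumes "S \<subseteq> P" "S \<noteq> {}"
    and common: "\<And>f g x y. f \<in> poly_fun X \<Longrightarrow> g \<in> poly_fun X \<Longrightarrow> x \<in> S \<Longrightarrow> y \<in> S \<Longrightarrow>
      f x \<noteq> 0 \<Longrightarrow> g y \<noteq> 0 \<Longrightarrow> \<exists>z\<in>S. f z \<noteq> 0 \<and> g z \<noteq> 0"
  shows "irreducible_space (subtopology (zariski P X) S)"
proof -
  have top: "topspace (subtopology (zariski P X) S) = S"
    using assms(1) by (auto simp: topspace_subtopology)
  show ?thesis
    unfolding irreducible_space_def top
  proof (intro conjI allI impI)
    fix C D
    assume CD: "closedin (subtopology (zariski P X) S) C \<and>
      closedin (subtopology (zariski P X) S) D \<and> C \<union> D = S"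
    obtain F where F: "F \<subseteq> poly_fun X" "C = zero_locus P F \<inter> S"
      using CD unfolding closedin_subtopology closedin_zariski by blast
    obtain G where G: "G \<subseteq> poly_fun X" "D = zero_locus P G \<inter> S"
      using CD unfolding closedin_subtopology closedin_zariski by blast
    show "C = S \<or> D = S"
    proof (rule ccontr)
      assume neg: "\<not> (C = S \<or> D = S)"
      obtain x f where x: "x \<in> S" "f \<in> F" "f x \<noteq> 0"
        using neg F(2) assms(1) unfolding zero_locus_def by blast
      obtain y g where y: "y \<in> S" "g \<in> G" "g y \<noteq> 0"
        using neg G(2) assms(1) unfolding zero_locus_def by blast
      obtain z where "z \<in> S" "f z \<noteq> 0" "g z \<noteq> 0"
        using common[of f g x y] x y F(1) G(1) by blast
      then show False
        using CD F(2) G(2) x(2) y(2) unfolding zero_locus_def by blast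
    qed
  qed (rule assms(2))
qed

text \<open>Inside the ambient space this is the Zariski closure of \<open>W\<close>.\<close>

definition poly_hull :: "('p \<Rightarrow> 'a::comm_ring_1) set \<Rightarrow> 'p set \<Rightarrow> 'p set" where
  "poly_hull X W = {x. \<forall>f\<in>poly_fun X. f x \<noteq> 0 \<longrightarrow> (\<exists>w\<in>W. f w \<noteq> 0)}"

lemma poly_hull_superset: "W \<subseteq> poly_hull X W"
  unfolding poly_hull_def by blast

definition poly_curve :: "nat \<Rightarrow> ('a::comm_ring_1 \<Rightarrow> 'a mat) \<Rightarrow> bool" where
  "poly_curve n M \<longleftrightarrow> (\<forall>x. M x \<in> carrier_mat n n) \<and>
     (\<forall>i<n. \<forall>j<n. \<exists>p. \<forall>x. M x $$ (i, j) = poly p x)"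

lemma poly_curve_const: "M \<in> carrier_mat n n \<Longrightarrow> poly_curve n (\<lambda>_. M)"
  unfolding poly_curve_def by (metis poly_const_conv)

lemma poly_curve_add:
  assumes "poly_curve n M" "poly_curve n N"
  shows "poly_curve n (\<lambda>x. M x + N x)"
  unfolding poly_curve_def
proof (intro conjI allI impI)
  show "M x + N x \<in> carrier_mat n n" for x
    using assms unfolding poly_curve_def by simp
  fix i j assume ij: "i < n" "j < n"
  obtain p q where "\<And>x. M x $$ (i, j) = poly p x" "\<And>x. N x $$ (i, j) = poly q x"
    using assms ij unfolding poly_curve_def by metis
  moreover have "N x \<in> carrier_mat n n" for x
    using assms unfolding poly_curve_def by simp
  ultimately have "\<forall>x. (M x + N x) $$ (i, j) = poly (p + q) x"
    using ij by (metis carrier_matD index_add_mat(1) poly_add)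
  then show "\<exists>p. \<forall>x. (M x + N x) $$ (i, j) = poly p x" ..
qed

lemma poly_curve_smult:
  assumes "poly_curve n M"
  shows "poly_curve n (\<lambda>x. poly c x \<cdot>\<^sub>m M x)"
  unfolding poly_curve_def
proof (intro conjI allI impI)
  show "poly c x \<cdot>\<^sub>m M x \<in> carrier_mat n n" for x
    using assms unfolding poly_curve_def by simp
  fix i j assume ij: "i < n" "j < n"
  obtain p where "\<And>x. M x $$ (i, j) = poly p x"
    using assms ij unfolding poly_curve_def by metis
  moreover have "M x \<in> carrier_mat n n" for x
    using assms unfolding poly_curve_def by simp
  ultimately have "\<forall>x. (poly c x \<cdot>\<^sub>m M x) $$ (i, j) = poly (c * p) x"
    using ij by (metis carrier_matD index_smult_mat(1) poly_mult)
  then show "\<exists>p. \<forall>x. (poly c x \<cdot>\<^sub>m M x) $$ (i, j) = poly p x" ..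
qed

lemma poly_curve_mult:
  assumes "poly_curve n M" "poly_curve n N"
  shows "poly_curve n (\<lambda>x. M x * N x)"
  unfolding poly_curve_def
proof (intro conjI allI impI)
  have c: "M x \<in> carrier_mat n n" "N x \<in> carrier_mat n n" for x
    using assms unfolding poly_curve_def by simp_all
  then show "M x * N x \<in> carrier_mat n n" for x
    by (metis mult_carrier_mat)
  fix i j assume ij: "i < n" "j < n"
  have "\<forall>k. \<exists>p. k < n \<longrightarrow> (\<forall>x. M x $$ (i, k) = poly p x)"
    using assms(1) ij unfolding poly_curve_def by blast
  then obtain p where p: "\<And>k x. k < n \<Longrightarrow> M x $$ (i, k) = poly (p k) x"
    by metis
  have "\<forall>k. \<exists>p. k < n \<longrightarrow> (\<forall>x. N x $$ (k, j) = poly p x)"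
    using assms(2) ij unfolding poly_curve_def by blast
  then obtain q where q: "\<And>k x. k < n \<Longrightarrow> N x $$ (k, j) = poly (q k) x"
    by metis
  have "(M x * N x) $$ (i, j) = poly (\<Sum>k = 0..<n. p k * q k) x" for x
  proof -
    have "(M x * N x) $$ (i, j) = (\<Sum>k = 0..<n. M x $$ (i, k) * N x $$ (k, j))"
      using ij carrier_matD[OF c(1)[of x]] carrier_matD[OF c(2)[of x]]
      by (simp add: scalar_prod_def)
    then show ?thesis
      by (simp add: p q poly_sum)
  qed
  then show "\<exists>p. \<forall>x. (M x * N x) $$ (i, j) = poly p x" by blast
qed

lemma poly_curve_linear:
  assumes "M \<in> carrier_mat n n" "N \<in> carrier_mat n n"
  shows "poly_curve n (\<lambda>x. M + x \<cdot>\<^sub>m N)"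
  using poly_curve_add[OF poly_curve_const[OF assms(1)]
      poly_curve_smult[OF poly_curve_const[OF assms(2)], of "[:0, 1:]"]]
  by simp

text \<open>Pulling back along a curve turns nonvanishing on pairs of matrices into a question about
  roots of a univariate polynomial.\<close>

lemma poly_fun_along_curve:
  assumes "f \<in> poly_fun (mat_pair_coords n)" "poly_curve n M" "poly_curve n N"
  shows "\<exists>p. \<forall>x. f (M x, N x) = poly p x"
  using assms(1)
proof induction
  case (const c)
  then show ?case by (metis poly_const_conv)
next
  case (coord f)
  then show ?case
    using assms(2,3) unfolding mat_pair_coords_def poly_curve_def by auto
next
  case (add f g)
  then show ?case by (metis poly_add)
next
  case (mult f g)
  then show ?case by (metis poly_mult)
qed

text \<open>If \<open>f\<close> is nonzero at the parameter \<open>y\<close>, its pullback is a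
  nonzero polynomial, and the infinite field has a parameter outside \<open>S\<close> and outside
  the roots.\<close>

lemma poly_hull_curve_limit:
  fixes M N :: "'a::alg_closed_field \<Rightarrow> 'a mat"
  assumes "poly_curve n M" "poly_curve n N" "finite S"
    and "\<And>x. x \<notin> S \<Longrightarrow> (M x, N x) \<in> W"
  shows "(M y, N y) \<in> poly_hull (mat_pair_coords n) W"
  unfolding poly_hull_def
proof (clarify)
  fix f :: "'a mat \<times> 'a mat \<Rightarrow> 'a"
  assume f: "f \<in> poly_fun (mat_pair_coords n)" "f (M y, N y) \<noteq> 0"
  obtain p where p: "\<And>x. f (M x, N x) = poly p x"
    using poly_fun_along_curve[OF f(1) assms(1,2)] by blast
  have "p \<noteq> 0"
    using f(2) p by auto
  then obtain x where "x \<notin> S" "poly p x \<noteq> 0"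
    using finite_nonroots_imp_common[OF _ _ assms(3)] by metis
  then show "\<exists>w\<in>W. f w \<noteq> 0"
    using assms(4) p by metis
qed

text \<open>Density moves the two points of nonvanishing into \<open>W\<close>. On the curve through
  them both pullbacks are nonzero polynomials, which have a common nonroot. The curve only has to
  stay in \<open>S\<close>, not in \<open>W\<close>.\<close>

lemma irreducible_spaceI_poly_curves:
  fixes S W :: "('a::alg_closed_field mat \<times> 'a mat) set"
  assumes "S \<subseteq> carrier_mat n n \<times> carrier_mat n n" "S \<noteq> {}"
    and dense: "S \<subseteq> poly_hull (mat_pair_coords n) W"
    and curves: "\<And>v w. v \<in> W \<Longrightarrow> w \<in> W \<Longrightarrow> \<exists>M N a b. poly_curve n M \<and> poly_curve n N \<and>
      (M a, N a) = v \<and> (M b, N b) = w \<and> (\<forall>x. (M x, N x) \<in> S)"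
  shows "irreducible_space (subtopology (zariski_mat_pair n) S)"
  unfolding zariski_mat_pair_def
proof (rule irreducible_space_zariskiI[OF assms(1,2)])
  fix f g :: "'a mat \<times> 'a mat \<Rightarrow> 'a" and x y
  assume fg: "f \<in> poly_fun (mat_pair_coords n)" "g \<in> poly_fun (mat_pair_coords n)"
    and "x \<in> S" "y \<in> S" "f x \<noteq> 0" "g y \<noteq> 0"
  then obtain v w where vw: "v \<in> W" "w \<in> W" "f v \<noteq> 0" "g w \<noteq> 0"
    using dense unfolding poly_hull_def by blast
  obtain M N a b where curve: "poly_curve n M" "poly_curve n N"
    and ends: "(M a, N a) = v" "(M b, N b) = w"
    and S: "\<And>x. (M x, N x) \<in> S"
    using curves[OF vw(1,2)] by blast
  obtain p where p: "\<And>x. f (M x, N x) = poly p x"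
    using poly_fun_along_curve[OF fg(1) curve] by blast
  obtain q where q: "\<And>x. g (M x, N x) = poly q x"
    using poly_fun_along_curve[OF fg(2) curve] by blast
  have "poly p a \<noteq> 0" "poly q b \<noteq> 0"
    using vw(3,4) p[of a] q[of b] ends by auto
  then have "p \<noteq> 0" "q \<noteq> 0"
    by auto
  then obtain x where "poly p x \<noteq> 0" "poly q x \<noteq> 0"
    using finite_nonroots_imp_common[of p q "{}"] by blast
  then show "\<exists>z\<in>S. f z \<noteq> 0 \<and> g z \<noteq> 0"
    using S p q by metis
qed

lemma poly_fun_swap:
  assumes "f \<in> poly_fun (mat_pair_coords n)"
  shows "(\<lambda>(B, C). f (C, B)) \<in> poly_fun (mat_pair_coords n)"
  using assms
proof induction
  case (const c)
  then show ?case using poly_fun.const[of c] by (simp add: case_prod_unfold)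
next
  case (coord f)
  then have "(\<lambda>(B, C). f (C, B)) \<in> mat_pair_coords n"
    unfolding mat_pair_coords_def by fastforce
  then show ?case by (rule poly_fun.coord)
next
  case (add f g)
  then show ?case using poly_fun.add[OF add.IH] by (simp add: case_prod_unfold)
next
  case (mult f g)
  then show ?case using poly_fun.mult[OF mult.IH] by (simp add: case_prod_unfold)
qed

text \<open>The exchange of coordinates preserves polynomial functions, so it is enough that it
  takes \<open>W\<close> into the closure of \<open>W\<close>.\<close>

lemma poly_hull_swap:
  assumes "(B, C) \<in> poly_hull (mat_pair_coords n) W"
    and "\<And>B C. (B, C) \<in> W \<Longrightarrow> (C, B) \<in> poly_hull (mat_pair_coords n) W"
  shows "(C, B) \<in> poly_hull (mat_pair_coords n) W"
  unfolding poly_hull_def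
proof (clarify)
  fix f :: "'a mat \<times> 'a mat \<Rightarrow> 'a"
  assume f: "f \<in> poly_fun (mat_pair_coords n)" "f (C, B) \<noteq> 0"
  then obtain B' C' where "(B', C') \<in> W" "f (C', B') \<noteq> 0"
    using assms(1) poly_fun_swap[OF f(1)] unfolding poly_hull_def by force
  then show "\<exists>w\<in>W. f w \<noteq> 0"
    using assms(2) f(1) unfolding poly_hull_def by blast
qed

section \<open>Matrices of linear maps\<close>

lemma mult_mat_unit_vec:
  fixes M :: "'a::semiring_1 mat"
  assumes "M \<in> carrier_mat m n" "j < n"
  shows "M *\<^sub>v unit_vec n j = col M j"
  using assms by (intro eq_vecI) auto

lemma smult_mat_mult_vec:
  fixes M :: "'a::comm_ring_1 mat"
  assumes "M \<in> carrier_mat m n" "v \<in> carrier_vec n"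
  shows "(c \<cdot>\<^sub>m M) *\<^sub>v v = c \<cdot>\<^sub>v (M *\<^sub>v v)"
  using assms by (intro eq_vecI) (auto simp: scalar_prod_def sum_distrib_left mult.assoc)

lemma zero_mat_mult_vec:
  fixes v :: "'a::semiring_1 vec"
  shows "v \<in> carrier_vec n \<Longrightarrow> 0\<^sub>m m n *\<^sub>v v = 0\<^sub>v m"
  by (intro eq_vecI) auto

lemma linear_map_has_matrix:
  fixes L :: "'a::field vec \<Rightarrow> 'a vec"
  assumes carrier: "\<And>v. v \<in> carrier_vec n \<Longrightarrow> L v \<in> carrier_vec n"
    and add: "\<And>v w. v \<in> carrier_vec n \<Longrightarrow> w \<in> carrier_vec n \<Longrightarrow> L (v + w) = L v + L w"
    and smult: "\<And>c v. v \<in> carrier_vec n \<Longrightarrow> L (c \<cdot>\<^sub>v v) = c \<cdot>\<^sub>v L v"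
  shows "\<exists>M\<in>carrier_mat n n. \<forall>v\<in>carrier_vec n. M *\<^sub>v v = L v"
proof -
  define M where "M = mat n n (\<lambda>(i, j). L (unit_vec n j) $ i)"
  have M: "M \<in> carrier_mat n n"
    unfolding M_def by simp
  have unit: "M *\<^sub>v unit_vec n j = L (unit_vec n j)" if "j < n" for j
  proof -
    have "col M j = L (unit_vec n j)"
      using that carrier[of "unit_vec n j"] unfolding M_def by (intro eq_vecI) auto
    then show ?thesis
      by (simp add: mult_mat_unit_vec[OF M that])
  qed
  have "M *\<^sub>v v = L v" if v: "v \<in> carrier_vec n" for v
  proof -
    define tr where "tr k = vec n (\<lambda>i. if i < k then v $ i else 0)" for k
    have tr_c: "tr k \<in> carrier_vec n" for k
      unfolding tr_def by simp
    have "M *\<^sub>v tr k = L (tr k)" if "k \<le> n" for k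
      using that
    proof (induction k)
      case 0
      have zero: "0 \<cdot>\<^sub>v v = 0\<^sub>v n" if "v \<in> carrier_vec n" for v :: "'a vec"
        using that by (intro eq_vecI) auto
      have "tr 0 = 0\<^sub>v n"
        unfolding tr_def by (intro eq_vecI) auto
      moreover have "M *\<^sub>v 0\<^sub>v n = 0\<^sub>v n"
        using M by (intro eq_vecI) auto
      moreover have "L (0\<^sub>v n) = 0\<^sub>v n"
        using smult[of "0\<^sub>v n" 0] zero[OF carrier[of "0\<^sub>v n"]] zero[of "0\<^sub>v n"] by simp
      ultimately show ?case
        by simp
    next
      case (Suc k)
      have k: "k < n"
        using Suc.prems by simp
      have step: "tr (Suc k) = tr k + v $ k \<cdot>\<^sub>v unit_vec n k"
        unfolding tr_def using k by (intro eq_vecI) (auto simp: less_Suc_eq)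
      have "M *\<^sub>v tr (Suc k) = M *\<^sub>v tr k + v $ k \<cdot>\<^sub>v (M *\<^sub>v unit_vec n k)"
        unfolding step using M tr_c
        by (subst mult_add_distrib_mat_vec[OF M]) (auto simp: mult_mat_vec[OF M])
      also have "\<dots> = L (tr (Suc k))"
        using Suc.IH k unit[OF k] tr_c unfolding step by (simp add: add smult)
      finally show ?case .
    qed
    moreover have "tr n = v"
      unfolding tr_def using v by (intro eq_vecI) auto
    ultimately show ?thesis
      by (metis order_refl)
  qed
  then show ?thesis
    using M by blast
qed

lemma mat_eqI_mult_vec:
  fixes M N :: "'a::field mat"
  assumes "M \<in> carrier_mat n n" "N \<in> carrier_mat n n"
    and "\<And>v. v \<in> carrier_vec n \<Longrightarrow> M *\<^sub>v v = N *\<^sub>v v"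
  shows "M = N"
proof (rule eq_matI)
  fix i j assume "i < dim_row N" "j < dim_col N"
  then have ij: "i < n" "j < n"
    using assms(2) by auto
  have "col M j = col N j"
    using assms(3)[of "unit_vec n j"] mult_mat_unit_vec[OF assms(1) ij(2)]
      mult_mat_unit_vec[OF assms(2) ij(2)] by simp
  then show "M $$ (i, j) = N $$ (i, j)"
    using assms(1,2) ij by (metis carrier_matD(1,2) index_col)
qed (use assms(1,2) in auto)

section \<open>Truncated polynomials\<close>

definition polyX :: "'a::comm_ring_1 poly" where
  "polyX = [:0, 1:]"

lemma poly_polyX [simp]: "poly polyX x = x"
  unfolding polyX_def by simp

lemma polyX_nonzero [simp]: "(polyX :: 'a::idom poly) \<noteq> 0"
  unfolding polyX_def by simp

lemma polyX_dvd_iff: "polyX dvd (f :: 'a::idom poly) \<longleftrightarrow> poly f 0 = 0"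
  unfolding polyX_def using poly_eq_0_iff_dvd[of f 0] by simp

lemma polyX_pow_dvd_imp_poly_0:
  "polyX ^ k dvd f \<Longrightarrow> 0 < k \<Longrightarrow> poly (f :: 'a::idom poly) 0 = 0"
  by (metis dvd_power dvd_trans polyX_dvd_iff)

lemma polyX_pow_add_dvd_iff:
  "polyX ^ (k + m) dvd polyX ^ k * (f :: 'a::idom poly) \<longleftrightarrow> polyX ^ m dvd f"
  by (simp add: power_add)

lemma polyX_pow_inverse:
  fixes f :: "'a::field poly"
  assumes "poly f 0 \<noteq> 0"
  shows "\<exists>g. polyX ^ k dvd 1 - g * f"
proof (induction k)
  case (Suc k)
  then obtain g h where gh: "1 - g * f = polyX ^ k * h"
    by (auto elim: dvdE)
  \<comment> \<open>The coefficient of the correction is chosen so that the next error, divided by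
    \<open>polyX ^ k\<close>, vanishes at 0.\<close>
  define g' where "g' = g + smult (poly h 0 / poly f 0) (polyX ^ k)"
  have "1 - g' * f = polyX ^ k * (h - smult (poly h 0 / poly f 0) f)"
    using gh unfolding g'_def by (simp add: algebra_simps)
  moreover have "polyX dvd h - smult (poly h 0 / poly f 0) f"
    using assms by (simp add: polyX_dvd_iff)
  ultimately have "polyX ^ Suc k dvd 1 - g' * f"
    by (metis dvd_refl mult_dvd_mono power_Suc2)
  then show ?case by blast
qed simp

text \<open>Modulo \<open>polyX ^ k\<close>, a vector with a unit coordinate spans every vector
  parallel to it; the factor is read off at the unit coordinate.\<close>

lemma minors_dvd_imp_proportional:
  fixes x y z x' y' z' :: "'a::field poly"
  assumes minors: "polyX ^ k dvd x * y' - x' * y" "polyX ^ k dvd x * z' - x' * z"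
      "polyX ^ k dvd y * z' - y' * z"
    and nz: "\<not> (poly x 0 = 0 \<and> poly y 0 = 0 \<and> poly z 0 = 0)"
  shows "\<exists>c. polyX ^ k dvd x' - c * x \<and> polyX ^ k dvd y' - c * y \<and> polyX ^ k dvd z' - c * z"
proof -
  have pivot: "\<exists>c. polyX ^ k dvd f' - c * f \<and> (\<forall>h h'. polyX ^ k dvd f * h' - f' * h \<longrightarrow> polyX ^ k dvd h' - c * h)"
    if f: "poly f 0 \<noteq> 0" for f f' :: "'a poly"
  proof -
    obtain g where g: "polyX ^ k dvd 1 - g * f"
      using polyX_pow_inverse[OF f] by blast
    have "f' - f' * g * f = (1 - g * f) * f'"
      by (simp add: algebra_simps)
    then have "polyX ^ k dvd f' - f' * g * f"
      using g by simp
    moreover have "polyX ^ k dvd h' - f' * g * h" if m: "polyX ^ k dvd f * h' - f' * h" for h h'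
    proof -
      have "h' - f' * g * h = (1 - g * f) * h' + (f * h' - f' * h) * g"
        by (simp add: algebra_simps)
      then show ?thesis
        using g m by (metis dvd_add dvd_mult2)
    qed
    ultimately show ?thesis by blast
  qed
  have minors': "polyX ^ k dvd y * x' - y' * x" "polyX ^ k dvd z * x' - z' * x"
      "polyX ^ k dvd z * y' - z' * y"
    using minors by (simp_all add: dvd_diff_commute mult.commute)
  consider "poly x 0 \<noteq> 0" | "poly y 0 \<noteq> 0" | "poly z 0 \<noteq> 0"
    using nz by blast
  then show ?thesis
  proof cases
    case 1
    then show ?thesis using pivot[of x x'] minors minors' by blast
  next
    case 2
    then show ?thesis using pivot[of y y'] minors minors' by blast
  next
    case 3
    then show ?thesis using pivot[of z z'] minors minors' by blast
  qed
qed

section \<open>The centralizer of a 2-regular nilpotent matrix\<close>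

text \<open>\<open>\<psi>\<close> presents the \<open>\<F>[t]\<close>-module given by \<open>A\<close> as \<open>\<F>[t]/(t^a) \<oplus> \<F>[t]/(t^b)\<close>.\<close>

locale two_block =
  fixes A :: "'a::alg_closed_field mat" and n a b d :: nat
    and \<psi> :: "'a poly \<Rightarrow> 'a poly \<Rightarrow> 'a vec"
  assumes A_carrier: "A \<in> carrier_mat n n"
    and a_eq: "a = b + d"
    and a_pos: "0 < a"
    and psi_carrier [simp]: "\<psi> f g \<in> carrier_vec n"
    and psi_add: "\<psi> (f + f') (g + g') = \<psi> f g + \<psi> f' g'"
    and psi_smult: "\<psi> (smult c f) (smult c g) = c \<cdot>\<^sub>v \<psi> f g"
    and psi_surj: "v \<in> carrier_vec n \<Longrightarrow> \<exists>f g. v = \<psi> f g"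
    and psi_zero_iff: "\<psi> f g = 0\<^sub>v n \<longleftrightarrow> polyX ^ a dvd f \<and> polyX ^ b dvd g"
    and A_psi: "A *\<^sub>v \<psi> f g = \<psi> (polyX * f) (polyX * g)"
begin

lemma psi_eq_iff: "\<psi> f g = \<psi> f' g' \<longleftrightarrow> polyX ^ a dvd f - f' \<and> polyX ^ b dvd g - g'"
proof -
  have "\<psi> f g = \<psi> (f - f') (g - g') + \<psi> f' g'"
    using psi_add[of "f - f'" f' "g - g'" g'] by simp
  moreover have "v + w = w \<longleftrightarrow> v = 0\<^sub>v n" if "v \<in> carrier_vec n" "w \<in> carrier_vec n" for v w :: "'a vec"
  proof
    assume "v + w = w"
    then have "v $ i + w $ i = w $ i" if "i < n" for i
      using that \<open>w \<in> carrier_vec n\<close> by (metis carrier_vecD index_add_vec(1))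
    then show "v = 0\<^sub>v n"
      using that(1) by (intro eq_vecI) auto
  qed (use that in simp)
  ultimately show ?thesis
    using psi_zero_iff[of "f - f'" "g - g'"] by simp
qed

lemma mat_eqI_psi:
  assumes "M \<in> carrier_mat n n" "N \<in> carrier_mat n n"
    and "\<And>f g. M *\<^sub>v \<psi> f g = N *\<^sub>v \<psi> f g"
  shows "M = N"
  using assms psi_surj by (intro mat_eqI_mult_vec) auto

text \<open>The formula does not depend on representatives: \<open>polyX ^ d\<close> carries
  multiples of \<open>polyX ^ b\<close> to multiples of \<open>polyX ^ a\<close>, and the latter are
  multiples of \<open>polyX ^ b\<close>.\<close>

lemma Phi_exists:
  "\<exists>M. M \<in> carrier_mat n n \<and>
     (\<forall>f g. M *\<^sub>v \<psi> f g = \<psi> (p * f + polyX ^ d * q * g) (r * f + s * g))"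
proof -
  define rep where "rep v = (SOME x. v = \<psi> (fst x) (snd x))" for v
  define L where "L v = \<psi> (p * fst (rep v) + polyX ^ d * q * snd (rep v))
    (r * fst (rep v) + s * snd (rep v))" for v
  have rep: "\<psi> f g = \<psi> (fst (rep (\<psi> f g))) (snd (rep (\<psi> f g)))" for f g
  proof -
    have "\<exists>x. \<psi> f g = \<psi> (fst x) (snd x)"
      by (metis fst_conv snd_conv)
    then show ?thesis
      unfolding rep_def by (rule someI_ex)
  qed
  have L_psi: "L (\<psi> f g) = \<psi> (p * f + polyX ^ d * q * g) (r * f + s * g)" for f g
  proof -
    define f' g' where "f' = fst (rep (\<psi> f g))" and "g' = snd (rep (\<psi> f g))"
    have f: "polyX ^ a dvd f' - f" and g: "polyX ^ b dvd g' - g"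
      using rep[of f g, symmetric] psi_eq_iff unfolding f'_def g'_def by blast+
    have f_b: "polyX ^ b dvd f' - f"
      using f a_eq by (metis dvd_trans le_imp_power_dvd le_add1)
    have g_a: "polyX ^ a dvd polyX ^ d * (g' - g)"
      using g polyX_pow_add_dvd_iff[of d b "g' - g"] a_eq by (simp add: add.commute)
    have "p * f' + polyX ^ d * q * g' - (p * f + polyX ^ d * q * g)
        = p * (f' - f) + q * (polyX ^ d * (g' - g))"
      and "r * f' + s * g' - (r * f + s * g) = r * (f' - f) + s * (g' - g)"
      by (simp_all add: algebra_simps)
    then show ?thesis
      unfolding L_def f'_def[symmetric] g'_def[symmetric] psi_eq_iff
      using f g f_b g_a by (simp add: dvd_add)
  qed
  have "\<exists>M\<in>carrier_mat n n. \<forall>v\<in>carrier_vec n. M *\<^sub>v v = L v"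
  proof (rule linear_map_has_matrix)
    show "L v \<in> carrier_vec n" for v
      unfolding L_def by simp
    show "L (v + w) = L v + L w" if vw: "v \<in> carrier_vec n" "w \<in> carrier_vec n" for v w
    proof -
      obtain f g f' g' where eq: "v = \<psi> f g" "w = \<psi> f' g'"
        using psi_surj[OF vw(1)] psi_surj[OF vw(2)] by blast
      show ?thesis
        unfolding eq psi_add[symmetric] L_psi by (simp add: algebra_simps)
    qed
    show "L (c \<cdot>\<^sub>v v) = c \<cdot>\<^sub>v L v" if v: "v \<in> carrier_vec n" for c v
    proof -
      obtain f g where eq: "v = \<psi> f g"
        using psi_surj[OF v] by blast
      show ?thesis
        unfolding eq psi_smult[symmetric] L_psi by (simp add: smult_add_right)
    qed
  qed
  then show ?thesis
    using L_psi by auto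
qed

text \<open>The factor \<open>t^d\<close> generates the homomorphisms \<open>\<F>[t]/(t^b) \<rightarrow> \<F>[t]/(t^a)\<close>, so these are all endomorphisms.\<close>

definition Phi :: "'a poly \<Rightarrow> 'a poly \<Rightarrow> 'a poly \<Rightarrow> 'a poly \<Rightarrow> 'a mat" where
  "Phi p q r s = (SOME M. M \<in> carrier_mat n n \<and>
     (\<forall>f g. M *\<^sub>v \<psi> f g = \<psi> (p * f + polyX ^ d * q * g) (r * f + s * g)))"

lemma Phi_carrier [simp]: "Phi p q r s \<in> carrier_mat n n"
  and Phi_psi: "Phi p q r s *\<^sub>v \<psi> f g = \<psi> (p * f + polyX ^ d * q * g) (r * f + s * g)"
  using someI_ex[OF Phi_exists[of p q r s], folded Phi_def] by blast+

lemma Phi_add: "Phi p q r s + Phi p' q' r' s' = Phi (p + p') (q + q') (r + r') (s + s')"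
proof (rule mat_eqI_psi)
  fix f g
  have "(Phi p q r s + Phi p' q' r' s') *\<^sub>v \<psi> f g = Phi p q r s *\<^sub>v \<psi> f g + Phi p' q' r' s' *\<^sub>v \<psi> f g"
    by (rule add_mult_distrib_mat_vec[OF Phi_carrier Phi_carrier psi_carrier])
  also have "\<dots> = Phi (p + p') (q + q') (r + r') (s + s') *\<^sub>v \<psi> f g"
    by (simp add: Phi_psi psi_add[symmetric] algebra_simps)
  finally show "(Phi p q r s + Phi p' q' r' s') *\<^sub>v \<psi> f g
      = Phi (p + p') (q + q') (r + r') (s + s') *\<^sub>v \<psi> f g" .
qed auto

lemma Phi_smult: "c \<cdot>\<^sub>m Phi p q r s = Phi (smult c p) (smult c q) (smult c r) (smult c s)"
proof (rule mat_eqI_psi)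
  fix f g
  have "(c \<cdot>\<^sub>m Phi p q r s) *\<^sub>v \<psi> f g = c \<cdot>\<^sub>v (Phi p q r s *\<^sub>v \<psi> f g)"
    by (rule smult_mat_mult_vec[OF Phi_carrier psi_carrier])
  also have "\<dots> = Phi (smult c p) (smult c q) (smult c r) (smult c s) *\<^sub>v \<psi> f g"
    by (simp add: Phi_psi psi_smult[symmetric] smult_add_right)
  finally show "(c \<cdot>\<^sub>m Phi p q r s) *\<^sub>v \<psi> f g
      = Phi (smult c p) (smult c q) (smult c r) (smult c s) *\<^sub>v \<psi> f g" .
qed auto

lemma Phi_mult:
  "Phi p q r s * Phi p' q' r' s' =
     Phi (p * p' + polyX ^ d * q * r') (p * q' + q * s')
       (r * p' + s * r') (polyX ^ d * r * q' + s * s')"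
proof (rule mat_eqI_psi)
  fix f g
  have "(Phi p q r s * Phi p' q' r' s') *\<^sub>v \<psi> f g = Phi p q r s *\<^sub>v (Phi p' q' r' s' *\<^sub>v \<psi> f g)"
    by (rule assoc_mult_mat_vec[OF Phi_carrier Phi_carrier psi_carrier])
  also have "\<dots> = Phi (p * p' + polyX ^ d * q * r') (p * q' + q * s')
       (r * p' + s * r') (polyX ^ d * r * q' + s * s') *\<^sub>v \<psi> f g"
    by (simp add: Phi_psi algebra_simps)
  finally show "(Phi p q r s * Phi p' q' r' s') *\<^sub>v \<psi> f g = Phi (p * p' + polyX ^ d * q * r') (p * q' + q * s')
       (r * p' + s * r') (polyX ^ d * r * q' + s * s') *\<^sub>v \<psi> f g" .
qed (auto intro: mult_carrier_mat[OF Phi_carrier Phi_carrier])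

text \<open>The entries are read off from the images of the two generators. The upper right entry
  \<open>polyX ^ d * q\<close> modulo \<open>polyX ^ a\<close> determines \<open>q\<close> modulo
  \<open>polyX ^ b\<close>, because \<open>a = b + d\<close>.\<close>

lemma Phi_eq_iff:
  "Phi p q r s = Phi p' q' r' s' \<longleftrightarrow> polyX ^ a dvd p - p' \<and> polyX ^ b dvd q - q' \<and>
     polyX ^ b dvd r - r' \<and> polyX ^ b dvd s - s'" (is "?lhs \<longleftrightarrow> ?rhs")
proof
  have shift: "polyX ^ d * q - polyX ^ d * q' = polyX ^ d * (q - q')"
    by (simp add: algebra_simps)
  assume eq: ?lhs
  have "\<psi> p r = \<psi> p' r'"
    using Phi_psi[of p q r s 1 0] Phi_psi[of p' q' r' s' 1 0] eq by simp
  moreover have "\<psi> (polyX ^ d * q) s = \<psi> (polyX ^ d * q') s'"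
    using Phi_psi[of p q r s 0 1] Phi_psi[of p' q' r' s' 0 1] eq by simp
  ultimately show ?rhs
    unfolding psi_eq_iff shift
    using polyX_pow_add_dvd_iff[of d b "q - q'"] a_eq by (simp add: add.commute)
next
  assume rhs: ?rhs
  show ?lhs
  proof (rule mat_eqI_psi)
    fix f g
    have "polyX ^ a dvd polyX ^ d * (q - q')"
      using rhs polyX_pow_add_dvd_iff[of d b "q - q'"] a_eq by (simp add: add.commute)
    moreover have "p * f + polyX ^ d * q * g - (p' * f + polyX ^ d * q' * g)
        = (p - p') * f + (polyX ^ d * (q - q')) * g"
      and "r * f + s * g - (r' * f + s' * g) = (r - r') * f + (s - s') * g"
      by (simp_all add: algebra_simps)
    ultimately show "Phi p q r s *\<^sub>v \<psi> f g = Phi p' q' r' s' *\<^sub>v \<psi> f g"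
      unfolding Phi_psi psi_eq_iff using rhs by (simp add: dvd_add)
  qed auto
qed

lemma Phi_one: "Phi 1 0 0 1 = 1\<^sub>m n"
  by (rule mat_eqI_psi) (auto simp: Phi_psi)

lemma Phi_zero: "Phi 0 0 0 0 = 0\<^sub>m n n"
proof -
  have "\<psi> 0 0 = 0\<^sub>v n"
    by (simp add: psi_zero_iff)
  then show ?thesis
    by (intro mat_eqI_psi) (auto simp: Phi_psi)
qed

lemma Phi_polyX: "Phi polyX 0 0 polyX = A"
  by (rule mat_eqI_psi) (auto simp: Phi_psi A_psi A_carrier)

text \<open>Both diagonal entries of the commutator are, up to sign, \<open>polyX ^ d\<close> times
  the last minor. Their vanishing modulo \<open>polyX ^ a\<close> amounts to divisibility of that
  minor by \<open>polyX ^ b\<close>.\<close>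

lemma Phi_commute_iff:
  "Phi p q r s * Phi p' q' r' s' = Phi p' q' r' s' * Phi p q r s \<longleftrightarrow>
     polyX ^ b dvd (p - s) * q' - (p' - s') * q \<and>
     polyX ^ b dvd (p - s) * r' - (p' - s') * r \<and>
     polyX ^ b dvd q * r' - q' * r"
proof -
  have "p * p' + polyX ^ d * q * r' - (p' * p + polyX ^ d * q' * r) = polyX ^ d * (q * r' - q' * r)"
    and "p * q' + q * s' - (p' * q + q' * s) = (p - s) * q' - (p' - s') * q"
    and "r * p' + s * r' - (r' * p + s' * r) = (p' - s') * r - (p - s) * r'"
    and "polyX ^ d * r * q' + s * s' - (polyX ^ d * r' * q + s' * s) = - (polyX ^ d * (q * r' - q' * r))"
    by (simp_all add: algebra_simps)
  then show ?thesis
    unfolding Phi_mult Phi_eq_iff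
    using polyX_pow_add_dvd_iff[of d b "q * r' - q' * r"] a_eq
    by (auto simp: add.commute dvd_diff_commute[of _ "(p' - s') * r"])
qed

text \<open>A module endomorphism is determined by the images of the two generators. Since
  \<open>polyX ^ b\<close> kills the second one, the first component of its image is divisible by
  \<open>polyX ^ d\<close>.\<close>

lemma Phi_surj:
  assumes M: "M \<in> carrier_mat n n" and comm: "A * M = M * A"
  shows "\<exists>p q r s. M = Phi p q r s"
proof -
  have M_shift: "M *\<^sub>v \<psi> (polyX * f) (polyX * g) = A *\<^sub>v (M *\<^sub>v \<psi> f g)" for f g
    using assoc_mult_mat_vec[OF A_carrier M psi_carrier] assoc_mult_mat_vec[OF M A_carrier psi_carrier]
      comm A_psi by metis
  have M_psi: "M *\<^sub>v \<psi> f g \<in> carrier_vec n" for f g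
    using M by (metis mult_mat_vec_carrier psi_carrier)
  obtain p r where pr: "M *\<^sub>v \<psi> 1 0 = \<psi> p r"
    using psi_surj[OF M_psi] by blast
  obtain q' s where qs: "M *\<^sub>v \<psi> 0 1 = \<psi> q' s"
    using psi_surj[OF M_psi] by blast
  have zero: "M *\<^sub>v \<psi> 0 0 = \<psi> 0 0"
  proof -
    have "\<psi> 0 0 = 0\<^sub>v n" by (simp add: psi_zero_iff)
    then show ?thesis using M by (intro eq_vecI) auto
  qed
  have pCons_eq: "pCons c f = smult c 1 + polyX * f" for c and f :: "'a poly"
    unfolding polyX_def by simp
  have M_add: "M *\<^sub>v (v + w) = M *\<^sub>v v + M *\<^sub>v w" if "v \<in> carrier_vec n" "w \<in> carrier_vec n" for v w
    using mult_add_distrib_mat_vec[OF M] that by blast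
  have M1: "M *\<^sub>v \<psi> f 0 = \<psi> (p * f) (r * f)" for f
  proof (induction f)
    case 0
    then show ?case using zero by simp
  next
    case (pCons c f)
    have "\<psi> (pCons c f) 0 = c \<cdot>\<^sub>v \<psi> 1 0 + \<psi> (polyX * f) (polyX * 0)"
      unfolding pCons_eq using psi_add[of "smult c 1" "polyX * f" "smult c 0" "polyX * 0"]
      by (simp add: psi_smult[symmetric])
    then have "M *\<^sub>v \<psi> (pCons c f) 0 = c \<cdot>\<^sub>v (M *\<^sub>v \<psi> 1 0) + A *\<^sub>v (M *\<^sub>v \<psi> f 0)"
      using M by (simp add: M_add M_shift[symmetric] mult_mat_vec[OF M])
    also have "\<dots> = \<psi> (smult c p + polyX * (p * f)) (smult c r + polyX * (r * f))"
      by (simp add: pr pCons.IH A_psi psi_add psi_smult)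
    finally show ?case
      unfolding pCons_eq by (simp add: algebra_simps)
  qed
  have M2: "M *\<^sub>v \<psi> 0 f = \<psi> (q' * f) (s * f)" for f
  proof (induction f)
    case 0
    then show ?case using zero by simp
  next
    case (pCons c f)
    have "\<psi> 0 (pCons c f) = c \<cdot>\<^sub>v \<psi> 0 1 + \<psi> (polyX * 0) (polyX * f)"
      unfolding pCons_eq using psi_add[of "smult c 0" "polyX * 0" "smult c 1" "polyX * f"]
      by (simp add: psi_smult[symmetric])
    then have "M *\<^sub>v \<psi> 0 (pCons c f) = c \<cdot>\<^sub>v (M *\<^sub>v \<psi> 0 1) + A *\<^sub>v (M *\<^sub>v \<psi> 0 f)"
      using M by (simp add: M_add M_shift[symmetric] mult_mat_vec[OF M])
    also have "\<dots> = \<psi> (smult c q' + polyX * (q' * f)) (smult c s + polyX * (s * f))"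
      by (simp add: qs pCons.IH A_psi psi_add psi_smult)
    finally show ?case
      unfolding pCons_eq by (simp add: algebra_simps)
  qed
  have "\<psi> 0 (polyX ^ b) = \<psi> 0 0"
    by (simp add: psi_eq_iff)
  then have "\<psi> (q' * polyX ^ b) (s * polyX ^ b) = \<psi> 0 0"
    using M2[of "polyX ^ b"] zero by simp
  then have "polyX ^ (b + d) dvd polyX ^ b * q'"
    by (simp add: psi_eq_iff a_eq mult.commute)
  then obtain q where q: "q' = polyX ^ d * q"
    unfolding polyX_pow_add_dvd_iff by (auto elim: dvdE)
  have "M = Phi p q r s"
  proof (rule mat_eqI_psi)
    fix f g
    have "M *\<^sub>v \<psi> f g = M *\<^sub>v \<psi> f 0 + M *\<^sub>v \<psi> 0 g"
      using psi_add[of f 0 0 g] by (simp add: M_add[symmetric])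
    then show "M *\<^sub>v \<psi> f g = Phi p q r s *\<^sub>v \<psi> f g"
      by (simp add: M1 M2 q Phi_psi psi_add[symmetric])
  qed (use M in auto)
  then show ?thesis by blast
qed

lemma Phi_commutes_A: "A * Phi p q r s = Phi p q r s * A"
  unfolding Phi_polyX[symmetric] Phi_commute_iff by simp

end

text \<open>Dividing by \<open>2\<close> is not possible in characteristic \<open>2\<close>, where the first hypothesis takes over.\<close>

lemma square_proportional:
  fixes p P g D :: "'a::idom"
  assumes "p\<^sup>2 = g\<^sup>2 * P\<^sup>2" "2 * p = 2 * (g * P)"
  shows "p = g * P"
proof -
  have "(p - g * P)\<^sup>2 = p\<^sup>2 - (2 * p) * (g * P) + g\<^sup>2 * P\<^sup>2"
    by (simp add: power2_eq_square algebra_simps)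
  also have "\<dots> = 0"
    unfolding assms by (simp add: power2_eq_square algebra_simps)
  finally show ?thesis by simp
qed

lemma alg_closed_quadratic_root:
  fixes u v w :: "'a::alg_closed_field"
  assumes "w \<noteq> 0"
  shows "\<exists>x. u + v * x + w * x\<^sup>2 = 0"
proof -
  have "degree [:u, v, w:] > 0"
    using assms by simp
  then obtain x where "poly [:u, v, w:] x = 0"
    using alg_closed_imp_poly_has_root by blast
  then show ?thesis
    by (intro exI[of _ x]) (simp add: algebra_simps power2_eq_square)
qed

section \<open>Nilpotent elements of the centralizer\<close>

context two_block
begin

text \<open>For \<open>b > 0\<close>, trace and determinant of the endomorphism of \<open>\<F>\<^sup>2 = \<F>\<^sup>n / A \<F>\<^sup>n\<close> induced by \<open>Phi p q r s\<close> vanish.\<close>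

definition nil_rep :: "'a poly \<Rightarrow> 'a poly \<Rightarrow> 'a poly \<Rightarrow> 'a poly \<Rightarrow> bool" where
  "nil_rep p q r s \<longleftrightarrow> poly (p + s) 0 = 0 \<and> poly (p * s - polyX ^ d * q * r) 0 = 0"

text \<open>The value of \<open>polyX ^ d\<close> at 0 is \<open>0 ^ d\<close>: it is 1 for blocks
  of equal size and 0 otherwise. In the latter case the condition says that \<open>p\<close> and
  \<open>s\<close> vanish at 0.\<close>

lemma nil_rep_iff:
  "nil_rep p q r s \<longleftrightarrow> poly s 0 = - poly p 0 \<and> (poly p 0)\<^sup>2 = - (0 ^ d * poly q 0 * poly r 0)"
proof -
  have "x + y = 0 \<and> x * y - e = 0 \<longleftrightarrow> y = - x \<and> x\<^sup>2 = - e" for x y e :: 'a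
  proof
    assume h: "x + y = 0 \<and> x * y - e = 0"
    then have "y = - x"
      by (simp add: eq_neg_iff_add_eq_0 add.commute)
    then show "y = - x \<and> x\<^sup>2 = - e"
      using h by (auto simp: power2_eq_square)
  qed (simp add: power2_eq_square)
  then show ?thesis
    unfolding nil_rep_def by (simp add: poly_power)
qed

lemma Phi_zeroI:
  "polyX ^ a dvd p \<Longrightarrow> polyX ^ b dvd q \<Longrightarrow> polyX ^ b dvd r \<Longrightarrow> polyX ^ b dvd s \<Longrightarrow>
    Phi p q r s = 0\<^sub>m n n"
  unfolding Phi_zero[symmetric] Phi_eq_iff by simp

text \<open>By Cayley--Hamilton for \<open>2 \<times> 2\<close> matrices, \<open>M\<^sup>2 = A X\<close> with \<open>X\<close> in the centralizer.\<close>

lemma nilpotent_Phi: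
  assumes "nil_rep p q r s"
  shows "nilpotent_mat (Phi p q r s)"
proof -
  define M where "M = Phi p q r s"
  have M: "M \<in> carrier_mat n n"
    unfolding M_def by simp
  obtain g where g: "p + s = polyX * g"
    using assms unfolding nil_rep_def polyX_dvd_iff[symmetric] by (auto elim: dvdE)
  obtain h where h: "p * s - polyX ^ d * q * r = polyX * h"
    using assms unfolding nil_rep_def polyX_dvd_iff[symmetric] by (auto elim: dvdE)
  have g': "s = polyX * g - p"
    using g by (simp add: algebra_simps)
  have h': "polyX ^ d * q * r = p * (polyX * g - p) - polyX * h"
    using h g' by (simp add: algebra_simps)
  have square: "M * M = Phi (polyX * (g * p - h)) (polyX * (g * q)) (polyX * (g * r)) (polyX * (g * s - h))"
  proof -
    have "p * p + polyX ^ d * q * r = polyX * (g * p - h)"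
      unfolding h' by (simp add: algebra_simps)
    moreover have "p * q + q * s = polyX * (g * q)"
      unfolding g' by (simp add: algebra_simps)
    moreover have "r * p + s * r = polyX * (g * r)"
      unfolding g' by (simp add: algebra_simps)
    moreover have "polyX ^ d * r * q + s * s = polyX * (g * s - h)"
    proof -
      have "polyX ^ d * r * q = p * (polyX * g - p) - polyX * h"
        using h' by (simp add: mult.assoc mult.commute[of r])
      then show ?thesis
        unfolding g' by (simp add: algebra_simps)
    qed
    ultimately show ?thesis
      unfolding M_def Phi_mult by simp
  qed
  \<comment> \<open>Each factor \<open>M * M\<close> contributes a factor \<open>polyX\<close>, and
    \<open>polyX ^ a\<close> annihilates the module.\<close>
  have "\<exists>x y z w. M ^\<^sub>m (2 * k) = Phi (polyX ^ k * x) (polyX ^ k * y) (polyX ^ k * z) (polyX ^ k * w)" for k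
  proof (induction k)
    case 0
    have "M ^\<^sub>m (2 * 0) = Phi 1 0 0 1"
      using M Phi_one by simp
    then show ?case
      by (intro exI[of _ 1] exI[of _ 0]) simp
  next
    case (Suc k)
    then obtain x y z w where k:
      "M ^\<^sub>m (2 * k) = Phi (polyX ^ k * x) (polyX ^ k * y) (polyX ^ k * z) (polyX ^ k * w)"
      by blast
    have "M ^\<^sub>m (2 * Suc k) = M ^\<^sub>m (2 * k) * (M * M)"
      using M by (simp add: assoc_mult_mat[OF pow_carrier_mat[OF M] M M])
    also have "\<dots> = Phi (polyX ^ Suc k * (x * (g * p - h) + polyX ^ d * y * (g * r)))
        (polyX ^ Suc k * (x * (g * q) + y * (g * s - h)))
        (polyX ^ Suc k * (z * (g * p - h) + w * (g * r)))
        (polyX ^ Suc k * (polyX ^ d * z * (g * q) + w * (g * s - h)))"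
      unfolding k square Phi_mult by (simp add: algebra_simps)
    finally show ?case by blast
  qed
  then obtain x y z w where
    "M ^\<^sub>m (2 * a) = Phi (polyX ^ a * x) (polyX ^ a * y) (polyX ^ a * z) (polyX ^ a * w)"
    by blast
  also have "\<dots> = 0\<^sub>m n n"
  proof (rule Phi_zeroI)
    have "polyX ^ b dvd (polyX ^ a :: 'a poly)"
      unfolding a_eq by (simp add: le_imp_power_dvd)
    then show "polyX ^ b dvd polyX ^ a * y" "polyX ^ b dvd polyX ^ a * z" "polyX ^ b dvd polyX ^ a * w"
      by (simp_all add: dvd_mult2)
  qed simp
  finally show ?thesis
    unfolding nilpotent_mat_def M_def[symmetric] carrier_matD(1)[OF M] by blast
qed

text \<open>A nilpotent \<open>M\<close> makes \<open>c - M\<close> invertible modulo \<open>A\<close> for \<open>c \<noteq> 0\<close>, so the induced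
  \<open>2 \<times> 2\<close> matrix has no nonzero eigenvalue.\<close>

lemma nilpotent_mat_imp_nil_rep:
  assumes M: "M \<in> carrier_mat n n" "A * M = M * A" and nil: "nilpotent_mat M"
  shows "\<exists>p q r s. M = Phi p q r s \<and> nil_rep p q r s"
proof -
  obtain p q r s where rep: "M = Phi p q r s"
    using Phi_surj[OF M] by blast
  obtain k where k: "M ^\<^sub>m k = 0\<^sub>m n n"
    using nil M(1) unfolding nilpotent_mat_def by auto
  define L where "L c = Phi ([:c:] - p) (- q) (- r) ([:c:] - s)" for c
  have L: "L c \<in> carrier_mat n n" for c
    unfolding L_def by simp
  have L_add: "L c + M = Phi [:c:] 0 0 [:c:]" for c
    unfolding L_def rep Phi_add by simp
  \<comment> \<open>\<open>L c\<close> represents \<open>c - M\<close>, and by the geometric sum it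
    divides \<open>c ^ i - M ^ i\<close> within the centralizer; at \<open>i = k\<close> the power
    of \<open>M\<close> disappears.\<close>
  have inverse: "\<exists>x y z w. L c * Phi x y z w = Phi [:c ^ k:] 0 0 [:c ^ k:]" for c
  proof -
    have "\<exists>x y z w. L c * Phi x y z w + M ^\<^sub>m i = Phi [:c ^ i:] 0 0 [:c ^ i:]" for i
    proof (induction i)
      case 0
      have "L c * Phi 0 0 0 0 + M ^\<^sub>m 0 = Phi [:c ^ 0:] 0 0 [:c ^ 0:]"
        using L[of c] M(1) Phi_one by (simp add: Phi_zero one_pCons)
      then show ?case by blast
    next
      case (Suc i)
      then obtain x y z w where i: "L c * Phi x y z w + M ^\<^sub>m i = Phi [:c ^ i:] 0 0 [:c ^ i:]"
        by blast
      define Y where "Y = Phi x y z w"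
      have Y: "Y \<in> carrier_mat n n"
        unfolding Y_def by simp
      have Mi: "M ^\<^sub>m i \<in> carrier_mat n n"
        using M(1) by simp
      define S where "S = Phi [:c ^ i:] 0 0 [:c ^ i:]"
      have S: "S \<in> carrier_mat n n"
        unfolding S_def by simp
      have comm: "L c * S = S * L c"
        unfolding L_def S_def Phi_commute_iff by simp
      have "L c * (S + Y * M) + M ^\<^sub>m Suc i = (L c * S + (L c * Y) * M) + M ^\<^sub>m i * M"
        using L[of c] S Y M(1) by (simp add: mult_add_distrib_mat[of _ n n _ n])
      also have "\<dots> = L c * S + ((L c * Y) * M + M ^\<^sub>m i * M)"
        using L[of c] S Y M(1) Mi by (intro assoc_add_mat) auto
      also have "\<dots> = S * L c + (L c * Y + M ^\<^sub>m i) * M"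
        using L[of c] Y M(1) Mi comm by (simp add: add_mult_distrib_mat[of _ n n _ _ n])
      also have "\<dots> = S * (L c + M)"
        using i L[of c] S M(1) unfolding Y_def[symmetric] S_def[symmetric]
        by (simp add: mult_add_distrib_mat[of _ n n _ n])
      also have "\<dots> = Phi [:c ^ Suc i:] 0 0 [:c ^ Suc i:]"
        unfolding L_add S_def Phi_mult by (simp add: mult.commute)
      finally have "L c * (S + Y * M) + M ^\<^sub>m Suc i = Phi [:c ^ Suc i:] 0 0 [:c ^ Suc i:]" .
      moreover have "\<exists>x' y' z' w'. S + Y * M = Phi x' y' z' w'"
        unfolding S_def Y_def rep Phi_mult Phi_add by blast
      ultimately show ?case by metis
    qed
    from this[of k] obtain x y z w where "L c * Phi x y z w + M ^\<^sub>m k = Phi [:c ^ k:] 0 0 [:c ^ k:]"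
      by blast
    moreover have "L c * Phi x y z w \<in> carrier_mat n n"
      using L[of c] by (metis Phi_carrier mult_carrier_mat)
    ultimately show ?thesis
      unfolding k by (metis right_add_zero_mat)
  qed
  show ?thesis
  proof (cases "b = 0")
    case True
    \<comment> \<open>Modulo \<open>polyX ^ 0\<close> all polynomials agree, so the entries
      belonging to the trivial second block can be taken to be 0.\<close>
    then have rep': "M = Phi p 0 0 0"
      unfolding rep Phi_eq_iff by simp
    define c where "c = poly p 0"
    obtain x y z w where "L c * Phi x y z w = Phi [:c ^ k:] 0 0 [:c ^ k:]"
      using inverse by blast
    then have "polyX ^ a dvd ([:c:] - p) * x + polyX ^ d * (- q) * z - [:c ^ k:]"
      unfolding L_def Phi_mult Phi_eq_iff by blast
    then have "poly (([:c:] - p) * x + polyX ^ d * (- q) * z - [:c ^ k:]) 0 = 0"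
      using a_pos by (rule polyX_pow_dvd_imp_poly_0)
    then have "c ^ k = 0"
      using True a_eq a_pos by (auto simp: c_def power_0_left)
    then have "nil_rep p 0 0 0"
      unfolding nil_rep_def by (simp add: c_def)
    then show ?thesis
      using rep' by blast
  next
    case False
    then have b: "0 < b"
      by simp
    define e where "e = (0::'a) ^ d"
    \<comment> \<open>At 0, \<open>L c\<close> and its cofactor multiply to the scalar
      \<open>c ^ k\<close>. Determinants are multiplicative, so that of \<open>L c\<close> divides
      \<open>c ^ k * c ^ k\<close>.\<close>
    have det: "(c - poly p 0) * (c - poly s 0) - e * poly q 0 * poly r 0 \<noteq> 0" if c: "c \<noteq> 0" for c
    proof
      assume zero: "(c - poly p 0) * (c - poly s 0) - e * poly q 0 * poly r 0 = 0"
      obtain x y z w where "L c * Phi x y z w = Phi [:c ^ k:] 0 0 [:c ^ k:]"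
        using inverse by blast
      then have "polyX ^ a dvd ([:c:] - p) * x + polyX ^ d * (- q) * z - [:c ^ k:]"
        "polyX ^ b dvd ([:c:] - p) * y + (- q) * w - 0"
        "polyX ^ b dvd (- r) * x + ([:c:] - s) * z - 0"
        "polyX ^ b dvd polyX ^ d * (- r) * y + ([:c:] - s) * w - [:c ^ k:]"
        unfolding L_def Phi_mult Phi_eq_iff by blast+
      from this(1)[THEN polyX_pow_dvd_imp_poly_0, OF a_pos]
        this(2-4)[THEN polyX_pow_dvd_imp_poly_0, OF b]
      have eqs: "(c - poly p 0) * poly x 0 - e * poly q 0 * poly z 0 = c ^ k"
        "(c - poly p 0) * poly y 0 = poly q 0 * poly w 0"
        "(c - poly s 0) * poly z 0 = poly r 0 * poly x 0"
        "(c - poly s 0) * poly w 0 - e * poly r 0 * poly y 0 = c ^ k"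
        unfolding e_def by (simp_all add: algebra_simps poly_power)
      have "c ^ k * c ^ k = ((c - poly p 0) * (c - poly s 0) - e * poly q 0 * poly r 0)
          * (poly x 0 * poly w 0 - e * poly y 0 * poly z 0)"
      proof -
        define l1 l4 q0 r0 x0 y0 z0 w0 where "l1 = c - poly p 0" and "l4 = c - poly s 0"
          and "q0 = poly q 0" and "r0 = poly r 0" and "x0 = poly x 0" and "y0 = poly y 0"
          and "z0 = poly z 0" and "w0 = poly w 0"
        have "(l1 * l4 - e * q0 * r0) * (x0 * w0 - e * y0 * z0)
          = (l1 * x0 - e * q0 * z0) * (l4 * w0 - e * r0 * y0)
            - e * (l1 * y0 - q0 * w0) * (l4 * z0 - r0 * x0)"
          by (simp add: algebra_simps)
        then show ?thesis
          using eqs unfolding l1_def l4_def q0_def r0_def x0_def y0_def z0_def w0_def by simp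
      qed
      then show False
        using zero c by simp
    qed
    have "poly p 0 * poly s 0 - e * poly q 0 * poly r 0 = 0"
    proof -
      \<comment> \<open>By \<open>det\<close> every root of the characteristic polynomial is 0, so
        the determinant vanishes.\<close>
      obtain c where "(poly p 0 * poly s 0 - e * poly q 0 * poly r 0) + - (poly p 0 + poly s 0) * c + 1 * c\<^sup>2 = 0"
        using alg_closed_quadratic_root[of 1] by auto
      then have "(c - poly p 0) * (c - poly s 0) - e * poly q 0 * poly r 0 = 0"
        by (simp add: algebra_simps power2_eq_square)
      then have "c = 0"
        using det by blast
      then show ?thesis
        using \<open>(c - poly p 0) * (c - poly s 0) - e * poly q 0 * poly r 0 = 0\<close> by simp
    qed
    \<comment> \<open>With determinant 0 the trace is itself a root of the characteristic
      polynomial.\<close>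
    moreover from this have "poly p 0 + poly s 0 = 0"
      using det[of "poly p 0 + poly s 0"] by (auto simp: algebra_simps)
    ultimately have "nil_rep p q r s"
      unfolding nil_rep_def e_def by simp
    then show ?thesis
      using rep by blast
  qed
qed

lemma N2_iff:
  "(B, C) \<in> N2 n A \<longleftrightarrow> (\<exists>p q r s p' q' r' s'. B = Phi p q r s \<and> C = Phi p' q' r' s' \<and>
     nil_rep p q r s \<and> nil_rep p' q' r' s' \<and>
     polyX ^ b dvd (p - s) * q' - (p' - s') * q \<and>
     polyX ^ b dvd (p - s) * r' - (p' - s') * r \<and>
     polyX ^ b dvd q * r' - q' * r)" (is "?lhs \<longleftrightarrow> ?rhs")
proof
  assume lhs: ?lhs
  then obtain p q r s p' q' r' s' where
    rep: "B = Phi p q r s" "nil_rep p q r s" "C = Phi p' q' r' s'" "nil_rep p' q' r' s'"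
    using nilpotent_mat_imp_nil_rep[of B] nilpotent_mat_imp_nil_rep[of C] unfolding N2_def by blast
  have "B * C = C * B"
    using lhs unfolding N2_def by blast
  then show ?rhs
    using rep unfolding rep Phi_commute_iff by blast
next
  assume ?rhs
  then show ?lhs
    unfolding N2_def using nilpotent_Phi Phi_commutes_A Phi_commute_iff by auto
qed


section \<open>Density of the pairs with polynomially dependent entries\<close>

text \<open>The pairs \<open>(B, c(A) B + e(A))\<close> with nilpotent entries.\<close>

definition polynomial_pairs :: "('a mat \<times> 'a mat) set" where
  "polynomial_pairs = {(Phi p q r s, Phi (c * p + e) (c * q) (c * r) (c * s + e)) | p q r s c e.
     nil_rep p q r s \<and> poly e 0 = 0}"

lemma nil_rep_scale:
  assumes "nil_rep p q r s"
    and "poly p' 0 = h * poly p 0" "poly q' 0 = h * poly q 0" "poly r' 0 = h * poly r 0"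
      "poly s' 0 = h * poly s 0"
  shows "nil_rep p' q' r' s'"
proof -
  have "(h * poly p 0)\<^sup>2 = h\<^sup>2 * (- (0 ^ d * poly q 0 * poly r 0))"
    using assms(1) unfolding nil_rep_iff by (simp add: power_mult_distrib)
  then show ?thesis
    using assms unfolding nil_rep_iff by (simp add: power2_eq_square ac_simps)
qed

lemma nil_rep_polynomial:
  assumes "nil_rep p q r s" "poly e 0 = 0"
  shows "nil_rep (c * p + e) (c * q) (c * r) (c * s + e)"
  using assms(2) by (intro nil_rep_scale[OF assms(1), where h = "poly c 0"]) simp_all

lemma polynomial_pairs_subset_N2: "polynomial_pairs \<subseteq> N2 n A"
proof clarify
  fix B C assume "(B, C) \<in> polynomial_pairs"
  then obtain p q r s c e where BC: "B = Phi p q r s" "C = Phi (c * p + e) (c * q) (c * r) (c * s + e)"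
    and nil: "nil_rep p q r s" "poly e 0 = 0"
    unfolding polynomial_pairs_def by blast
  have "(p - s) * (c * q) - (c * p + e - (c * s + e)) * q = 0"
    "(p - s) * (c * r) - (c * p + e - (c * s + e)) * r = 0"
    "q * (c * r) - (c * q) * r = 0"
    by (simp_all add: algebra_simps)
  then show "(B, C) \<in> N2 n A"
    unfolding N2_iff BC using nil nil_rep_polynomial[OF nil] by (metis dvd_0_right)
qed

text \<open>For a nilpotent matrix the vector \<open>(p - s, q, r)\<close> determines
  \<open>p\<close> at 0: through \<open>p - s = 2 * p\<close> outside characteristic 2, and through
  the square of \<open>p\<close> in characteristic 2.\<close>

lemma nil_rep_proportional:
  assumes "nil_rep p q r s" "nil_rep p' q' r' s'"
    and "poly (p' - s') 0 = g * poly (p - s) 0"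
    and "poly q' 0 = g * poly q 0" "poly r' 0 = g * poly r 0"
  shows "poly p' 0 = g * poly p 0" "poly s' 0 = g * poly s 0"
proof -
  have "(poly p' 0)\<^sup>2 = g\<^sup>2 * (poly p 0)\<^sup>2"
    using assms(1,2,4,5) unfolding nil_rep_iff by (simp add: power2_eq_square)
  moreover have "2 * poly p' 0 = 2 * (g * poly p 0)"
    using assms(1-3) unfolding nil_rep_iff by (simp add: algebra_simps)
  ultimately show "poly p' 0 = g * poly p 0"
    by (rule square_proportional)
  then show "poly s' 0 = g * poly s 0"
    using assms(1,2) unfolding nil_rep_iff by simp
qed

lemma polynomial_pairsI:
  assumes nil: "nil_rep p q r s" "nil_rep p' q' r' s'"
    and parallel: "polyX ^ b dvd p' - s' - c * (p - s)"
      "polyX ^ b dvd q' - c * q" "polyX ^ b dvd r' - c * r"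
  shows "(Phi p q r s, Phi p' q' r' s') \<in> polynomial_pairs"
proof -
  define e where "e = p' - c * p"
  have "poly e 0 = 0"
  proof (cases "b = 0")
    case True
    \<comment> \<open>For \<open>b = 0\<close> the divisibility hypotheses are void, but nilpotency
      alone makes \<open>p\<close> and \<open>p'\<close> vanish at 0, as
      \<open>d > 0\<close>.\<close>
    then have "0 < d"
      using a_pos a_eq by simp
    then have "poly p 0 = 0" "poly p' 0 = 0"
      using nil unfolding nil_rep_iff by (simp_all add: power_0_left)
    then show ?thesis
      unfolding e_def by simp
  next
    case False
    then have "0 < b" by simp
    from parallel[THEN polyX_pow_dvd_imp_poly_0, OF this]
    have "poly p' 0 = poly c 0 * poly p 0"
      by (intro nil_rep_proportional(1)[OF nil]) simp_all
    then show ?thesis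
      unfolding e_def by simp
  qed
  moreover have "Phi p' q' r' s' = Phi (c * p + e) (c * q) (c * r) (c * s + e)"
  proof -
    have "s' - (c * s + e) = - (p' - s' - c * (p - s))" "p' - (c * p + e) = 0"
      unfolding e_def by (simp_all add: algebra_simps)
    then have "polyX ^ b dvd s' - (c * s + e)" "polyX ^ a dvd p' - (c * p + e)"
      using parallel(1) by (simp_all only: dvd_minus_iff dvd_0_right)
    then show ?thesis
      unfolding Phi_eq_iff using parallel(2,3) by blast
  qed
  ultimately show ?thesis
    unfolding polynomial_pairs_def using nil(1) by blast
qed

abbreviation pair_closure :: "('a mat \<times> 'a mat) set" where
  "pair_closure \<equiv> poly_hull (mat_pair_coords n) polynomial_pairs"

lemma pair_closure_line_limit:
  assumes "V \<in> carrier_mat n n" "V' \<in> carrier_mat n n" "B \<in> carrier_mat n n" "C \<in> carrier_mat n n"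
    and "finite S" and "\<And>x. x \<notin> S \<Longrightarrow> (B + x \<cdot>\<^sub>m V, C + x \<cdot>\<^sub>m V') \<in> polynomial_pairs"
  shows "(B, C) \<in> pair_closure"
proof -
  have "(B + 0 \<cdot>\<^sub>m V, C + 0 \<cdot>\<^sub>m V') \<in> pair_closure"
    using poly_hull_curve_limit[OF poly_curve_linear[OF assms(3,1)] poly_curve_linear[OF assms(4,2)] assms(5,6)] .
  moreover have "B + 0 \<cdot>\<^sub>m V = B" "C + 0 \<cdot>\<^sub>m V' = C"
    using assms(1-4) by (intro eq_matI; simp)+
  ultimately show ?thesis by simp
qed

text \<open>If \<open>C = c(A) B + e(A)\<close>, then \<open>B\<close> is a polynomial in \<open>A\<close> and \<open>C + x B\<close> for almost all \<open>x\<close>.\<close>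

lemma polynomial_pairs_swap:
  assumes "(B, C) \<in> polynomial_pairs"
  shows "(C, B) \<in> pair_closure"
proof -
  obtain p q r s c e where BC: "B = Phi p q r s" "C = Phi (c * p + e) (c * q) (c * r) (c * s + e)"
    and nil: "nil_rep p q r s" "poly e 0 = 0"
    using assms unfolding polynomial_pairs_def by blast
  \<comment> \<open>Here \<open>C + x B\<close> is \<open>(c + x) B + e\<close>, and
    \<open>c + x\<close> is a unit modulo \<open>polyX ^ b\<close> unless
    \<open>x = - poly c 0\<close>. Its inverse \<open>g\<close> expresses \<open>B\<close> through
    \<open>C + x B\<close>.\<close>
  have "(C + x \<cdot>\<^sub>m B, B + x \<cdot>\<^sub>m 0\<^sub>m n n) \<in> polynomial_pairs" if x: "x \<notin> {- poly c 0}" for x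
  proof -
    define c' where "c' = c + [:x:]"
    have eq: "C + x \<cdot>\<^sub>m B = Phi (c' * p + e) (c' * q) (c' * r) (c' * s + e)"
      unfolding BC Phi_smult Phi_add c'_def by (simp add: algebra_simps)
    have "poly c' 0 \<noteq> 0"
      using x unfolding c'_def by (simp add: eq_neg_iff_add_eq_0 add.commute)
    then obtain g where g: "polyX ^ b dvd 1 - g * c'"
      using polyX_pow_inverse by blast
    have "p - s - g * (c' * p + e - (c' * s + e)) = (1 - g * c') * (p - s)"
      "q - g * (c' * q) = (1 - g * c') * q" "r - g * (c' * r) = (1 - g * c') * r"
      by (simp_all add: algebra_simps)
    then have "(C + x \<cdot>\<^sub>m B, B) \<in> polynomial_pairs"
      unfolding eq unfolding BC(1)
      by (intro polynomial_pairsI[where c = g] nil_rep_polynomial nil) (simp_all only: dvd_mult2[OF g])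
    moreover have "B + x \<cdot>\<^sub>m 0\<^sub>m n n = B"
      unfolding BC(1) Phi_zero[symmetric] Phi_smult Phi_add by simp
    ultimately show ?thesis by simp
  qed
  then show ?thesis
    by (intro pair_closure_line_limit[of B "0\<^sub>m n n" C B "{- poly c 0}"]) (auto simp: BC)
qed

lemma pair_closure_swap: "(B, C) \<in> pair_closure \<Longrightarrow> (C, B) \<in> pair_closure"
  using poly_hull_swap polynomial_pairs_swap by blast

text \<open>The deformation is \<open>(B + x V, C + x c(A) V)\<close>, where \<open>C - c(A) B = A^j V + e(A)\<close>. The centralizer
  of the deformed first entry consists of the polynomials in it and \<open>A\<close>, as it is not a scalar modulo \<open>A\<close>.\<close>

lemma pair_closure_deformation:
  assumes nil: "nil_rep p q r s" "nil_rep p' q' r' s'" "nil_rep vp vq vr vs"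
    and comm: "polyX ^ b dvd (p - s) * q' - (p' - s') * q"
      "polyX ^ b dvd (p - s) * r' - (p' - s') * r"
      "polyX ^ b dvd q * r' - q' * r"
    and j: "j < b"
    and V: "polyX ^ b dvd p' - s' - c * (p - s) - polyX ^ j * (vp - vs)"
      "polyX ^ b dvd q' - c * q - polyX ^ j * vq"
      "polyX ^ b dvd r' - c * r - polyX ^ j * vr"
    and nz: "\<not> (poly (vp - vs) 0 = 0 \<and> poly vq 0 = 0 \<and> poly vr 0 = 0)"
  shows "(Phi p q r s, Phi p' q' r' s') \<in> pair_closure"
proof -
  have b: "0 < b" "b = j + (b - j)" "0 < b - j"
    using j by simp_all
  \<comment> \<open>The second vector is \<open>c\<close> times the first plus
    \<open>polyX ^ j\<close> times the vector of \<open>V\<close>, so the minors of the pair become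
    \<open>polyX ^ j\<close> times the minors of the first vector with \<open>V\<close>.\<close>
  have minor: "polyX ^ b dvd polyX ^ j * (x * w - y * v)"
    if "polyX ^ b dvd x * y' - x' * y" "polyX ^ b dvd x' - c * x - polyX ^ j * v"
      "polyX ^ b dvd y' - c * y - polyX ^ j * w" for x y x' y' v w :: "'a poly"
  proof -
    have "polyX ^ j * (x * w - y * v) = x * y' - x' * y + y * (x' - c * x - polyX ^ j * v)
        - x * (y' - c * y - polyX ^ j * w)"
      by (simp add: algebra_simps)
    then show ?thesis
      using that by (metis dvd_add dvd_diff dvd_mult)
  qed
  note minors = minor[OF comm(1) V(1,2)] minor[OF comm(2) V(1,3)] minor[OF comm(3) V(2,3)]
  have minors0: "polyX ^ (b - j) dvd (p - s) * vq - q * (vp - vs)"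
    "polyX ^ (b - j) dvd (p - s) * vr - r * (vp - vs)" "polyX ^ (b - j) dvd q * vr - r * vq"
    using minors polyX_pow_add_dvd_iff[of j "b - j"] b(2) by auto
  \<comment> \<open>Modulo \<open>polyX ^ (b - j)\<close> the first vector is a multiple of that of
    \<open>V\<close>, which has a unit entry. As \<open>b - j\<close> is positive, this can be
    evaluated at 0.\<close>
  have "\<exists>g. poly (p - s) 0 = g * poly (vp - vs) 0 \<and> poly q 0 = g * poly vq 0 \<and> poly r 0 = g * poly vr 0"
  proof -
    have "\<exists>g. polyX ^ (b - j) dvd (p - s) - g * (vp - vs) \<and> polyX ^ (b - j) dvd q - g * vq \<and>
      polyX ^ (b - j) dvd r - g * vr"
      using minors0 nz by (intro minors_dvd_imp_proportional) (simp_all add: dvd_diff_commute mult.commute)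
    then obtain g where g: "polyX ^ (b - j) dvd (p - s) - g * (vp - vs)" "polyX ^ (b - j) dvd q - g * vq"
      "polyX ^ (b - j) dvd r - g * vr"
      by blast
    from g[THEN polyX_pow_dvd_imp_poly_0, OF b(3)] show ?thesis
      by (intro exI[of _ "poly g 0"]) simp
  qed
  then obtain g where g: "poly (p - s) 0 = g * poly (vp - vs) 0" "poly q 0 = g * poly vq 0"
    "poly r 0 = g * poly vr 0"
    by blast
  \<comment> \<open>The same factor for the second matrix; \<open>0 ^ j\<close> is the value of
    \<open>polyX ^ j\<close> at 0.\<close>
  define g' where "g' = poly c 0 * g + 0 ^ j"
  have g': "poly (p' - s') 0 = g' * poly (vp - vs) 0" "poly q' 0 = g' * poly vq 0"
    "poly r' 0 = g' * poly vr 0"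
  proof -
    have eq: "u = v + w" if "u - v - w = 0" for u v w :: 'a
      using that by (simp add: diff_diff_eq)
    have "poly (p' - s') 0 = poly c 0 * poly (p - s) 0 + 0 ^ j * poly (vp - vs) 0"
      "poly q' 0 = poly c 0 * poly q 0 + 0 ^ j * poly vq 0"
      "poly r' 0 = poly c 0 * poly r 0 + 0 ^ j * poly vr 0"
      using V[THEN polyX_pow_dvd_imp_poly_0, OF b(1)] by (auto intro!: eq simp: poly_power)
    then show "poly (p' - s') 0 = g' * poly (vp - vs) 0" "poly q' 0 = g' * poly vq 0"
      "poly r' 0 = g' * poly vr 0"
      unfolding g g'_def distrib_right by (simp_all only: mult.assoc)
  qed
  note ps = nil_rep_proportional[OF nil(3,1) g] and ps' = nil_rep_proportional[OF nil(3,2) g']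
  \<comment> \<open>At 0 the deformed first matrix is \<open>g + x\<close> times \<open>V\<close>:
    it is nilpotent, and its vector is nonzero unless \<open>x = - g\<close>.\<close>
  have "(Phi p q r s + x \<cdot>\<^sub>m Phi vp vq vr vs, Phi p' q' r' s' + x \<cdot>\<^sub>m Phi (c * vp) (c * vq) (c * vr) (c * vs))
    \<in> polynomial_pairs" if x: "x \<notin> {- g}" for x
  proof -
    define P Q R S where "P = p + smult x vp" and "Q = q + smult x vq" and "R = r + smult x vr"
      and "S = s + smult x vs"
    define P' Q' R' S' where "P' = p' + smult x (c * vp)" and "Q' = q' + smult x (c * vq)"
      and "R' = r' + smult x (c * vr)" and "S' = s' + smult x (c * vs)"
    have gx: "g + x \<noteq> 0"
      using x by (auto simp: eq_neg_iff_add_eq_0 add.commute)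
    have nilP: "nil_rep P Q R S"
      by (rule nil_rep_scale[OF nil(3), where h = "g + x"]) (simp_all add: P_def Q_def R_def S_def g(2,3) ps algebra_simps)
    have nilP': "nil_rep P' Q' R' S'"
      by (rule nil_rep_scale[OF nil(3), where h = "g' + x * poly c 0"])
        (simp_all add: P'_def Q'_def R'_def S'_def g'(2,3) ps' algebra_simps)
    have nzP: "\<not> (poly (P - S) 0 = 0 \<and> poly Q 0 = 0 \<and> poly R 0 = 0)"
    proof -
      have "poly (P - S) 0 = (g + x) * poly (vp - vs) 0" "poly Q 0 = (g + x) * poly vq 0"
        "poly R 0 = (g + x) * poly vr 0"
        by (simp_all add: P_def Q_def R_def S_def g(2,3) ps algebra_simps)
      then show ?thesis
        using nz gx by simp
    qed
    \<comment> \<open>The deformation does not affect the second vector minus \<open>c\<close> times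
      the first, and adding a multiple of \<open>V\<close> to the first vector does not change its
      minors with \<open>V\<close>.\<close>
    have shifted_minor: "polyX ^ b dvd X * Y' - X' * Y"
      if "polyX ^ b dvd polyX ^ j * (x0 * w - y0 * v)" "polyX ^ b dvd x' - c * x0 - polyX ^ j * v"
        "polyX ^ b dvd y' - c * y0 - polyX ^ j * w"
        "X = x0 + smult x v" "Y = y0 + smult x w"
        "X' = x' + smult x (c * v)" "Y' = y' + smult x (c * w)"
      for X Y X' Y' x0 y0 x' y' v w
    proof -
      have "X * Y' - X' * Y = polyX ^ j * (x0 * w - y0 * v) + X * (y' - c * y0 - polyX ^ j * w)
          - Y * (x' - c * x0 - polyX ^ j * v)"
        unfolding that(4-7) by (simp add: algebra_simps smult_add_right)
      then show ?thesis
        using that(1-3) by (metis dvd_add dvd_diff dvd_mult)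
    qed
    have diff: "P - S = (p - s) + smult x (vp - vs)" "P' - S' = (p' - s') + smult x (c * (vp - vs))"
      unfolding P_def S_def P'_def S'_def by (simp_all add: algebra_simps smult_diff_right)
    have "\<exists>h. polyX ^ b dvd (P' - S') - h * (P - S) \<and> polyX ^ b dvd Q' - h * Q \<and> polyX ^ b dvd R' - h * R"
    proof (rule minors_dvd_imp_proportional)
      show "polyX ^ b dvd (P - S) * Q' - (P' - S') * Q"
        by (rule shifted_minor[OF minors(1) V(1,2) diff(1) Q_def diff(2) Q'_def])
      show "polyX ^ b dvd (P - S) * R' - (P' - S') * R"
        by (rule shifted_minor[OF minors(2) V(1,3) diff(1) R_def diff(2) R'_def])
      show "polyX ^ b dvd Q * R' - Q' * R"
        by (rule shifted_minor[OF minors(3) V(2,3) Q_def R_def Q'_def R'_def])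
    qed (rule nzP)
    then obtain h where "polyX ^ b dvd P' - S' - h * (P - S)" "polyX ^ b dvd Q' - h * Q"
      "polyX ^ b dvd R' - h * R"
      by blast
    then have "(Phi P Q R S, Phi P' Q' R' S') \<in> polynomial_pairs"
      by (rule polynomial_pairsI[OF nilP nilP'])
    then show ?thesis
      unfolding Phi_smult Phi_add P_def Q_def R_def S_def P'_def Q'_def R'_def S'_def .
  qed
  then show ?thesis
    by (intro pair_closure_line_limit[of "Phi vp vq vr vs" "Phi (c * vp) (c * vq) (c * vr) (c * vs)" _ _ "{- g}"]) auto
qed

text \<open>The discriminant of the \<open>2 \<times> 2\<close> matrix with diagonal difference \<open>x\<close> and off-diagonal
  entries \<open>0 ^ d * y\<close> and \<open>z\<close>. It vanishes iff a scalar shift of the matrix is nilpotent.\<close>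

definition disc :: "'a poly \<Rightarrow> 'a poly \<Rightarrow> 'a poly \<Rightarrow> 'a" where
  "disc x y z = (poly x 0)\<^sup>2 + 4 * (0 ^ d * poly y 0 * poly z 0)"

text \<open>The shift \<open>w\<close> is chosen to make the determinant zero. The square of the
  trace is four times the determinant plus \<open>disc\<close>, so the trace vanishes too, in every
  characteristic.\<close>

lemma disc_zero_imp_nil_rep:
  assumes "disc x y z = 0"
  shows "\<exists>w. nil_rep (x + w) y z w"
proof -
  define e where "e = 0 ^ d * poly y 0 * poly z 0"
  obtain w where w: "- e + poly x 0 * w + 1 * w\<^sup>2 = 0"
    using alg_closed_quadratic_root[OF one_neq_zero] by blast
  have "(2 * w + poly x 0)\<^sup>2 = 4 * (- e + poly x 0 * w + 1 * w\<^sup>2) + disc x y z"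
    unfolding disc_def e_def by (simp add: power2_eq_square algebra_simps)
  then have "(2 * w + poly x 0)\<^sup>2 = 0"
    unfolding w assms by simp
  then have "2 * w + poly x 0 = 0"
    by simp
  moreover have "(poly x 0 + w) * w - e = 0"
    using w by (simp add: power2_eq_square algebra_simps)
  ultimately have "nil_rep (x + [:w:]) y z [:w:]"
    unfolding nil_rep_def e_def by (simp add: poly_power algebra_simps)
  then show ?thesis by blast
qed

text \<open>As a function of \<open>m\<close> the discriminant is quadratic with leading coefficient
  \<open>disc x y z\<close>.\<close>

lemma disc_pencil_root:
  assumes "disc x y z \<noteq> 0"
  shows "\<exists>m. disc (x' - smult m x) (y' - smult m y) (z' - smult m z) = 0"
proof -
  define e where "e = (0::'a) ^ d"
  obtain m where m: "disc x' y' z' + (- 2 * poly x 0 * poly x' 0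
      - 4 * e * (poly y 0 * poly z' 0 + poly y' 0 * poly z 0)) * m + disc x y z * m\<^sup>2 = 0"
    using alg_closed_quadratic_root[OF assms] by blast
  have "disc (x' - smult m x) (y' - smult m y) (z' - smult m z) = disc x' y' z' + (- 2 * poly x 0 * poly x' 0
      - 4 * e * (poly y 0 * poly z' 0 + poly y' 0 * poly z 0)) * m + disc x y z * m\<^sup>2"
    unfolding disc_def e_def by (simp add: power2_eq_square algebra_simps)
  then show ?thesis
    using m by auto
qed

end

lemma maximal_nat_between:
  fixes P :: "nat \<Rightarrow> bool"
  assumes "P k" "k \<le> b"
  obtains j where "k \<le> j" "j \<le> b" "P j" "j < b \<Longrightarrow> \<not> P (Suc j)"
proof -
  define j where "j = Max {j. j \<le> b \<and> P j}"
  have fin: "finite {j. j \<le> b \<and> P j}"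
    by simp
  have mem: "j \<in> {j. j \<le> b \<and> P j}"
    unfolding j_def using assms by (intro Max_in fin) auto
  have max: "i \<le> j" if "i \<le> b" "P i" for i
    unfolding j_def using that by (intro Max_ge fin) simp
  show ?thesis
  proof (rule that)
    show "k \<le> j" "j \<le> b" "P j"
      using mem max assms by simp_all
    show "\<not> P (Suc j)" if "j < b"
      using max[of "Suc j"] that by auto
  qed
qed

lemma polyX_pow_factor3:
  fixes x y z :: "'a::idom poly"
  assumes "polyX ^ k dvd x" "polyX ^ k dvd y" "polyX ^ k dvd z"
    and "\<not> (polyX ^ Suc k dvd x \<and> polyX ^ Suc k dvd y \<and> polyX ^ Suc k dvd z)"
  obtains u v w where "x = polyX ^ k * u" "y = polyX ^ k * v" "z = polyX ^ k * w"
    "\<not> (poly u 0 = 0 \<and> poly v 0 = 0 \<and> poly w 0 = 0)"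
proof -
  obtain u v w where eq: "x = polyX ^ k * u" "y = polyX ^ k * v" "z = polyX ^ k * w"
    using assms(1-3) by (elim dvdE) blast
  have "polyX ^ Suc k dvd polyX ^ k * f" if "poly f 0 = 0" for f :: "'a poly"
    using that polyX_dvd_iff[of f] by (simp add: mult.commute)
  then show ?thesis
    using that eq assms(4) by blast
qed

text \<open>Square roots of \<open>q\<close> and \<open>- r\<close> determine \<open>p\<close> up to
  sign, and the sign is absorbed into \<open>v\<close>. This parametrizes the cone of nilpotent
  matrices with rows \<open>(p, q)\<close> and \<open>(r, - p)\<close> by a plane, where points are
  joined by segments.\<close>

lemma nilpotent_2x2_param:
  fixes p q r :: "'a::alg_closed_field"
  assumes "p\<^sup>2 = - (q * r)"
  obtains u v where "p = u * v" "q = u\<^sup>2" "r = - v\<^sup>2"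
proof -
  obtain u where u: "u\<^sup>2 = q"
    using nth_root_exists[of 2 q] by auto
  obtain v where v: "v\<^sup>2 = - r"
    using nth_root_exists[of 2 "- r"] by auto
  have "p\<^sup>2 = (u * v)\<^sup>2"
    using assms u v by (simp add: power_mult_distrib)
  then consider "p = u * v" | "p = u * (- v)"
    by (auto simp: power2_eq_iff)
  then show ?thesis
  proof cases
    case 1
    then show ?thesis using that[of u v] u v by simp
  next
    case 2
    then show ?thesis using that[of u "- v"] u v by simp
  qed
qed

section \<open>Reduction to leading vectors, and curves between polynomial pairs\<close>

context two_block
begin

text \<open>The vector of the first matrix has order \<open>k\<close>, that of the second at least
  \<open>k\<close>. If the leading vector of the first has a nilpotent shift, the roles are
  exchanged and it serves as \<open>V\<close> with \<open>c = 0\<close>. Otherwise its nonzero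
  discriminant provides a root in the pencil.\<close>

lemma pair_closure_of_valuation:
  assumes nil: "nil_rep p q r s" "nil_rep p' q' r' s'"
    and comm: "polyX ^ b dvd (p - s) * q' - (p' - s') * q"
      "polyX ^ b dvd (p - s) * r' - (p' - s') * r"
      "polyX ^ b dvd q * r' - q' * r"
    and v: "p - s = polyX ^ k * vx" "q = polyX ^ k * vy" "r = polyX ^ k * vz"
    and nz: "\<not> (poly vx 0 = 0 \<and> poly vy 0 = 0 \<and> poly vz 0 = 0)"
    and k: "k < b"
    and dvd': "polyX ^ k dvd p' - s'" "polyX ^ k dvd q'" "polyX ^ k dvd r'"
  shows "(Phi p q r s, Phi p' q' r' s') \<in> pair_closure"
proof -
  define good where "good j \<longleftrightarrow> (\<exists>c. polyX ^ j dvd p' - s' - c * (p - s) \<and>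
    polyX ^ j dvd q' - c * q \<and> polyX ^ j dvd r' - c * r)" for j
  \<comment> \<open>Starting the search at \<open>k\<close> ensures \<open>k \<le> j\<close>, so
    that \<open>polyX ^ (j - k)\<close> below is the true quotient.\<close>
  have "good k"
    unfolding good_def using dvd' by (intro exI[of _ 0]) simp
  then obtain j where j: "k \<le> j" "j \<le> b" "good j" "j < b \<Longrightarrow> \<not> good (Suc j)"
    using maximal_nat_between[of good k b] k by auto
  obtain c where c: "polyX ^ j dvd p' - s' - c * (p - s)" "polyX ^ j dvd q' - c * q"
    "polyX ^ j dvd r' - c * r"
    using j(3) unfolding good_def by metis
  show ?thesis
  proof (cases "j = b")
    case True
    show ?thesis
      by (rule subsetD[OF poly_hull_superset polynomial_pairsI[OF nil c[unfolded True]]])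
  next
    case False
    then have j_less: "j < b"
      using j(2) by simp
    from j(4)[OF this] have "\<not> (polyX ^ Suc j dvd p' - s' - c * (p - s) \<and>
      polyX ^ Suc j dvd q' - c * q \<and> polyX ^ Suc j dvd r' - c * r)"
      unfolding good_def by metis
    with c obtain wx wy wz where w: "p' - s' - c * (p - s) = polyX ^ j * wx"
      "q' - c * q = polyX ^ j * wy" "r' - c * r = polyX ^ j * wz"
      "\<not> (poly wx 0 = 0 \<and> poly wy 0 = 0 \<and> poly wz 0 = 0)"
      by (rule polyX_pow_factor3)
    show ?thesis
    proof (cases "disc vx vy vz = 0")
      case True
      then obtain e where e: "nil_rep (vx + e) vy vz e"
        using disc_zero_imp_nil_rep by blast
      have comm': "polyX ^ b dvd (p' - s') * q - (p - s) * q'"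
        "polyX ^ b dvd (p' - s') * r - (p - s) * r'" "polyX ^ b dvd q' * r - q * r'"
        using comm by (simp_all only: dvd_diff_commute)
      have "(Phi p' q' r' s', Phi p q r s) \<in> pair_closure"
        using nz by (intro pair_closure_deformation[OF nil(2,1) e comm' k, where c = 0]) (simp_all add: v)
      then show ?thesis
        by (rule pair_closure_swap)
    next
      case False
      then obtain m where m: "disc (wx - smult m vx) (wy - smult m vy) (wz - smult m vz) = 0"
        using disc_pencil_root by blast
      \<comment> \<open>This change of \<open>c\<close> subtracts \<open>m\<close> times the leading
        vector of the first matrix from the leading vector of the remainder.\<close>
      define c' where "c' = c + smult m (polyX ^ (j - k))"
      have shift: "f' - c' * f = polyX ^ j * (w - smult m v)"
        if "f' - c * f = polyX ^ j * w" "f = polyX ^ k * v" for f f' v w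
      proof -
        have "polyX ^ (j - k) * f = polyX ^ j * v"
          unfolding that(2) using j(1) by (simp add: mult.assoc[symmetric] power_add[symmetric])
        moreover have "f' - c' * f = (f' - c * f) - smult m (polyX ^ (j - k) * f)"
          unfolding c'_def by (simp add: algebra_simps)
        ultimately show ?thesis
          unfolding that(1) by (simp add: algebra_simps)
      qed
      note w' = shift[OF w(1) v(1)] shift[OF w(2) v(2)] shift[OF w(3) v(3)]
      obtain e where e: "nil_rep (wx - smult m vx + e) (wy - smult m vy) (wz - smult m vz) e"
        using disc_zero_imp_nil_rep[OF m] by blast
      \<comment> \<open>If the new leading vector vanished at 0, then \<open>c'\<close> would
        witness \<open>good (Suc j)\<close>, against the maximality of \<open>j\<close>.\<close>
      have "\<not> (poly (wx - smult m vx) 0 = 0 \<and> poly (wy - smult m vy) 0 = 0 \<and> poly (wz - smult m vz) 0 = 0)"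
      proof
        assume "poly (wx - smult m vx) 0 = 0 \<and> poly (wy - smult m vy) 0 = 0 \<and> poly (wz - smult m vz) 0 = 0"
        then have "polyX ^ Suc j dvd p' - s' - c' * (p - s) \<and>
          polyX ^ Suc j dvd q' - c' * q \<and> polyX ^ Suc j dvd r' - c' * r"
          unfolding w' polyX_dvd_iff[symmetric] by (simp add: mult.commute[of polyX])
        then show False
          using j(4)[OF j_less] unfolding good_def by blast
      qed
      then show ?thesis
        by (intro pair_closure_deformation[OF nil e comm j_less, where c = c']) (simp_all add: w')
    qed
  qed
qed

text \<open>Orders are capped at \<open>b\<close>, since the vectors matter only modulo
  \<open>polyX ^ b\<close>. If both reach \<open>b\<close>, both matrices are polynomials in
  \<open>A\<close>; otherwise the one of smaller order is put first.\<close>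

lemma N2_subset_pair_closure: "N2 n A \<subseteq> pair_closure"
proof clarify
  fix B C assume "(B, C) \<in> N2 n A"
  then obtain p q r s p' q' r' s' where BC: "B = Phi p q r s" "C = Phi p' q' r' s'"
    and nil: "nil_rep p q r s" "nil_rep p' q' r' s'"
    and comm: "polyX ^ b dvd (p - s) * q' - (p' - s') * q"
      "polyX ^ b dvd (p - s) * r' - (p' - s') * r" "polyX ^ b dvd q * r' - q' * r"
    unfolding N2_iff by blast
  have comm': "polyX ^ b dvd (p' - s') * q - (p - s) * q'"
    "polyX ^ b dvd (p' - s') * r - (p - s) * r'" "polyX ^ b dvd q' * r - q * r'"
    using comm by (simp_all only: dvd_diff_commute)
  define val where "val x y z k \<longleftrightarrow> polyX ^ k dvd x \<and> polyX ^ k dvd y \<and> polyX ^ k dvd z"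
    for x y z :: "'a poly" and k
  have val_mono: "val x y z i" if "val x y z k" "i \<le> k" for x y z i k
    using that unfolding val_def by (meson dvd_trans le_imp_power_dvd)
  obtain k where k: "k \<le> b" "val (p - s) q r k" "k < b \<Longrightarrow> \<not> val (p - s) q r (Suc k)"
    using maximal_nat_between[of "val (p - s) q r" 0 b] unfolding val_def by auto
  obtain k' where k': "k' \<le> b" "val (p' - s') q' r' k'" "k' < b \<Longrightarrow> \<not> val (p' - s') q' r' (Suc k')"
    using maximal_nat_between[of "val (p' - s') q' r'" 0 b] unfolding val_def by auto
  consider "k = b" "k' = b" | "k < b" "k \<le> k'" | "k' < b" "k' \<le> k"
    using k(1) k'(1) by linarith
  then show "(B, C) \<in> pair_closure"
  proof cases
    case 1
    then have "(B, C) \<in> polynomial_pairs"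
      unfolding BC using k'(2) by (intro polynomial_pairsI[OF nil, where c = 0]) (simp_all add: val_def)
    then show ?thesis
      by (rule subsetD[OF poly_hull_superset])
  next
    case 2
    have "polyX ^ k dvd p - s" "polyX ^ k dvd q" "polyX ^ k dvd r"
      "\<not> (polyX ^ Suc k dvd p - s \<and> polyX ^ Suc k dvd q \<and> polyX ^ Suc k dvd r)"
      using k(2) k(3)[OF 2(1)] unfolding val_def by simp_all
    then obtain u v w where uvw: "p - s = polyX ^ k * u" "q = polyX ^ k * v" "r = polyX ^ k * w"
      "\<not> (poly u 0 = 0 \<and> poly v 0 = 0 \<and> poly w 0 = 0)"
      by (rule polyX_pow_factor3)
    have "polyX ^ k dvd p' - s'" "polyX ^ k dvd q'" "polyX ^ k dvd r'"
      using val_mono[OF k'(2) 2(2)] unfolding val_def by simp_all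
    then show ?thesis
      unfolding BC by (rule pair_closure_of_valuation[OF nil comm uvw 2(1)])
  next
    case 3
    have "polyX ^ k' dvd p' - s'" "polyX ^ k' dvd q'" "polyX ^ k' dvd r'"
      "\<not> (polyX ^ Suc k' dvd p' - s' \<and> polyX ^ Suc k' dvd q' \<and> polyX ^ Suc k' dvd r')"
      using k'(2) k'(3)[OF 3(1)] unfolding val_def by simp_all
    then obtain u v w where uvw: "p' - s' = polyX ^ k' * u" "q' = polyX ^ k' * v" "r' = polyX ^ k' * w"
      "\<not> (poly u 0 = 0 \<and> poly v 0 = 0 \<and> poly w 0 = 0)"
      by (rule polyX_pow_factor3)
    have "polyX ^ k' dvd p - s" "polyX ^ k' dvd q" "polyX ^ k' dvd r"
      using val_mono[OF k(2) 3(2)] unfolding val_def by simp_all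
    then have "(C, B) \<in> pair_closure"
      unfolding BC by (rule pair_closure_of_valuation[OF nil(2,1) comm' uvw 3(1)])
    then show ?thesis
      by (rule pair_closure_swap)
  qed
qed

text \<open>Nilpotency only constrains values at 0, so a straight segment is corrected by constant
  terms that vanish at both ends. For \<open>d > 0\<close> the constraint is linear and the
  correction is 0; for \<open>d = 0\<close> the values follow the parametrized cone with linear
  \<open>u\<close> and \<open>v\<close>.\<close>

lemma nilpotent_curve:
  assumes nil: "nil_rep p q r s" "nil_rep p' q' r' s'"
  shows "\<exists>P Q R S. poly_curve n (\<lambda>x. Phi (P x) (Q x) (R x) (S x)) \<and>
    (\<forall>x. nil_rep (P x) (Q x) (R x) (S x)) \<and>
    P 0 = p \<and> Q 0 = q \<and> R 0 = r \<and> S 0 = s \<and> P 1 = p' \<and> Q 1 = q' \<and> R 1 = r' \<and> S 1 = s'"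
proof -
  define seg where "seg f f' x = f + smult x (f' - f)" for f f' :: "'a poly" and x
  have "\<exists>hp hq hr. (\<forall>h\<in>{hp, hq, hr}. poly h 0 = 0 \<and> poly h 1 = 0) \<and>
    (\<forall>x. nil_rep (seg p p' x + [:poly hp x:]) (seg q q' x + [:poly hq x:])
      (seg r r' x + [:poly hr x:]) (seg s s' x - [:poly hp x:]))"
  proof (cases "d = 0")
    case False
    then show ?thesis
      using nil unfolding nil_rep_iff seg_def
      by (intro exI[of _ 0]) (simp add: power_0_left)
  next
    case True
    then have sq: "(poly p 0)\<^sup>2 = - (poly q 0 * poly r 0)" "(poly p' 0)\<^sup>2 = - (poly q' 0 * poly r' 0)"
      using nil unfolding nil_rep_iff by simp_all
    obtain u v where uv: "poly p 0 = u * v" "poly q 0 = u\<^sup>2" "poly r 0 = - v\<^sup>2"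
      using nilpotent_2x2_param[OF sq(1)] .
    obtain u' v' where uv': "poly p' 0 = u' * v'" "poly q' 0 = u'\<^sup>2" "poly r' 0 = - v'\<^sup>2"
      using nilpotent_2x2_param[OF sq(2)] .
    define U V where "U = [:u, u' - u:]" and "V = [:v, v' - v:]"
    define lin where "lin f f' = [:poly f 0, poly f' 0 - poly f 0:]" for f f' :: "'a poly"
    have seg0: "poly (seg f f' x) 0 = poly (lin f f') x" for f f' x
      unfolding seg_def lin_def by simp
    have S: "poly (seg s s' x) 0 = - poly (lin p p') x" for x
      using nil unfolding nil_rep_iff seg_def lin_def by (simp add: algebra_simps)
    show ?thesis
    proof (rule exI[of _ "U * V - lin p p'"], rule exI[of _ "U\<^sup>2 - lin q q'"],
        rule exI[of _ "- V\<^sup>2 - lin r r'"], intro conjI allI)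
      show "\<forall>h\<in>{U * V - lin p p', U\<^sup>2 - lin q q', - V\<^sup>2 - lin r r'}. poly h 0 = 0 \<and> poly h 1 = 0"
      proof -
        have "poly U 0 = u" "poly U 1 = u'" "poly V 0 = v" "poly V 1 = v'"
          unfolding U_def V_def by simp_all
        moreover have "poly (lin f f') 0 = poly f 0" "poly (lin f f') 1 = poly f' 0" for f f'
          unfolding lin_def by simp_all
        ultimately show ?thesis
          using uv uv' by (simp add: poly_power)
      qed
      show "nil_rep (seg p p' x + [:poly (U * V - lin p p') x:]) (seg q q' x + [:poly (U\<^sup>2 - lin q q') x:])
          (seg r r' x + [:poly (- V\<^sup>2 - lin r r') x:]) (seg s s' x - [:poly (U * V - lin p p') x:])" for x
        unfolding nil_rep_iff using True by (simp add: seg0[of p] seg0[of q] seg0[of r] S poly_power power_mult_distrib)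
    qed
  qed
  then obtain hp hq hr where h: "poly hp 0 = 0" "poly hp 1 = 0" "poly hq 0 = 0" "poly hq 1 = 0"
      "poly hr 0 = 0" "poly hr 1 = 0"
    and nil_seg: "\<And>x. nil_rep (seg p p' x + [:poly hp x:]) (seg q q' x + [:poly hq x:])
      (seg r r' x + [:poly hr x:]) (seg s s' x - [:poly hp x:])"
    by auto
  have "poly_curve n (\<lambda>x. (Phi p q r s + x \<cdot>\<^sub>m Phi (p' - p) (q' - q) (r' - r) (s' - s))
      + (poly hp x \<cdot>\<^sub>m Phi 1 0 0 (- 1) + (poly hq x \<cdot>\<^sub>m Phi 0 1 0 0 + poly hr x \<cdot>\<^sub>m Phi 0 0 1 0)))"
    by (intro poly_curve_add poly_curve_linear poly_curve_smult poly_curve_const) simp_all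
  also have "(\<lambda>x. (Phi p q r s + x \<cdot>\<^sub>m Phi (p' - p) (q' - q) (r' - r) (s' - s))
      + (poly hp x \<cdot>\<^sub>m Phi 1 0 0 (- 1) + (poly hq x \<cdot>\<^sub>m Phi 0 1 0 0 + poly hr x \<cdot>\<^sub>m Phi 0 0 1 0)))
    = (\<lambda>x. Phi (seg p p' x + [:poly hp x:]) (seg q q' x + [:poly hq x:])
      (seg r r' x + [:poly hr x:]) (seg s s' x - [:poly hp x:]))"
    unfolding Phi_smult Phi_add seg_def by (simp add: one_pCons diff_conv_add_uminus[of _ "[:_:]"] del: add_uminus_conv_diff)
  finally have "poly_curve n \<dots>" .
  then show ?thesis
    using nil_seg h
    by (intro exI[of _ "\<lambda>x. seg p p' x + [:poly hp x:]"] exI[of _ "\<lambda>x. seg q q' x + [:poly hq x:]"]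
      exI[of _ "\<lambda>x. seg r r' x + [:poly hr x:]"] exI[of _ "\<lambda>x. seg s s' x - [:poly hp x:]"])
      (simp add: seg_def)
qed

text \<open>The first entry follows a curve of nilpotent matrices while \<open>c\<close> and
  \<open>e\<close> move along segments, so the curve stays among the polynomial pairs.\<close>

lemma polynomial_pairs_curve:
  assumes "v \<in> polynomial_pairs" "w \<in> polynomial_pairs"
  shows "\<exists>M N x y. poly_curve n M \<and> poly_curve n N \<and> (M x, N x) = v \<and> (M y, N y) = w \<and>
    (\<forall>x. (M x, N x) \<in> N2 n A)"
proof -
  obtain p q r s c e where v: "v = (Phi p q r s, Phi (c * p + e) (c * q) (c * r) (c * s + e))"
      "nil_rep p q r s" "poly e 0 = 0"
    using assms(1) unfolding polynomial_pairs_def by blast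
  obtain p' q' r' s' c' e' where w: "w = (Phi p' q' r' s', Phi (c' * p' + e') (c' * q') (c' * r') (c' * s' + e'))"
      "nil_rep p' q' r' s'" "poly e' 0 = 0"
    using assms(2) unfolding polynomial_pairs_def by blast
  obtain P Q R S where curve: "poly_curve n (\<lambda>x. Phi (P x) (Q x) (R x) (S x))"
    and nil: "\<And>x. nil_rep (P x) (Q x) (R x) (S x)"
    and ends: "P 0 = p" "Q 0 = q" "R 0 = r" "S 0 = s" "P 1 = p'" "Q 1 = q'" "R 1 = r'" "S 1 = s'"
    using nilpotent_curve[OF v(2) w(2)] by blast
  define cx ex where "cx x = c + smult x (c' - c)" and "ex x = e + smult x (e' - e)" for x
  define M N where "M x = Phi (P x) (Q x) (R x) (S x)"
    and "N x = Phi (cx x * P x + ex x) (cx x * Q x) (cx x * R x) (cx x * S x + ex x)" for x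
  have "poly_curve n (\<lambda>x. (Phi c 0 0 c + x \<cdot>\<^sub>m Phi (c' - c) 0 0 (c' - c)) * M x
      + (Phi e 0 0 e + x \<cdot>\<^sub>m Phi (e' - e) 0 0 (e' - e)))"
    unfolding M_def by (intro poly_curve_add poly_curve_mult poly_curve_linear curve) simp_all
  also have "(\<lambda>x. (Phi c 0 0 c + x \<cdot>\<^sub>m Phi (c' - c) 0 0 (c' - c)) * M x
      + (Phi e 0 0 e + x \<cdot>\<^sub>m Phi (e' - e) 0 0 (e' - e))) = N"
    unfolding M_def N_def cx_def ex_def Phi_smult Phi_add Phi_mult by simp
  finally have "poly_curve n N" .
  moreover have "poly_curve n M"
    using curve unfolding M_def .
  moreover have "(M 0, N 0) = v" "(M 1, N 1) = w"
    unfolding M_def N_def cx_def ex_def v(1) w(1) by (simp_all add: ends)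
  moreover have "(M x, N x) \<in> polynomial_pairs" for x
  proof -
    have "poly (ex x) 0 = 0"
      unfolding ex_def using v(3) w(3) by simp
    then show ?thesis
      unfolding polynomial_pairs_def M_def N_def using nil[of x] by blast
  qed
  ultimately show ?thesis
    using polynomial_pairs_subset_N2 by blast
qed

theorem irreducible_N2: "irreducible_space (subtopology (zariski_mat_pair n) (N2 n A))"
proof (rule irreducible_spaceI_poly_curves)
  show "N2 n A \<subseteq> carrier_mat n n \<times> carrier_mat n n"
    unfolding N2_def by auto
  have "(Phi 0 0 0 0, Phi (0 * 0 + 0) (0 * 0) (0 * 0) (0 * 0 + 0)) \<in> polynomial_pairs"
    unfolding polynomial_pairs_def nil_rep_def by force
  then show "N2 n A \<noteq> {}"
    using polynomial_pairs_subset_N2 by blast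
  show "N2 n A \<subseteq> pair_closure"
    by (rule N2_subset_pair_closure)
qed (rule polynomial_pairs_curve)

end

section \<open>Existence of the two-block presentation\<close>

text \<open>The zero rows of the reduced row echelon form of \<open>A\<close> give a complement of the column space.\<close>

lemma kernel_dim_le_2_imp_two_cogenerators:
  fixes A :: "'a::field mat"
  assumes A: "A \<in> carrier_mat n n" and n: "0 < n" and ker: "kernel_dim A \<le> 2"
  shows "\<exists>e\<in>carrier_vec n. \<exists>f\<in>carrier_vec n. \<forall>v\<in>carrier_vec n. \<exists>w\<in>carrier_vec n. \<exists>x y.
    v = A *\<^sub>v w + (x \<cdot>\<^sub>v e + y \<cdot>\<^sub>v f)"
proof -
  define C where "C = gauss_jordan_single A"
  note gj = gauss_jordan_single[OF A C_def[symmetric]]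
  obtain P Q where PQ: "C = P * A" "P \<in> carrier_mat n n" "Q \<in> carrier_mat n n"
    "P * Q = 1\<^sub>m n" "Q * P = 1\<^sub>m n"
    using gj(4) by blast
  have C: "C \<in> carrier_mat n n"
    by (rule gj(2))
  obtain piv where piv: "pivot_fun C piv n"
    using gj(3) C unfolding row_echelon_form_def by auto
  note pivD = pivot_funD[OF carrier_matD(1)[OF C] piv]
  \<comment> \<open>\<open>N\<close> consists of the zero rows, marked by the pivot value
    \<open>n\<close>; their number is the dimension of the kernel.\<close>
  define N where "N = {i. i < n \<and> piv i = n}"
  define R where "R = {i. i < n \<and> piv i \<noteq> n}"
  have "length (pivot_positions C) = card (fst ` set (pivot_positions C))"
    using distinct_card[OF pivot_positions(2)[OF C piv]] by simp
  also have "fst ` set (pivot_positions C) = R"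
    unfolding pivot_positions(1)[OF C piv] R_def by force
  finally have "length (pivot_positions C) = card R" .
  then have "kernel_dim A = n - card R"
    using A unfolding kernel_dim_code C_def by simp
  moreover have "card N + card R = n"
  proof -
    have "card (N \<union> R) = card N + card R"
      by (rule card_Un_disjoint) (auto simp: N_def R_def)
    moreover have "N \<union> R = {..<n}"
      unfolding N_def R_def by auto
    ultimately show ?thesis by simp
  qed
  ultimately have "card N \<le> 2"
    using ker by linarith
  then have "\<exists>i1 i2. i1 < n \<and> i2 < n \<and> N \<subseteq> {i1, i2}"
  proof -
    consider "card N = 0" | "card N = 1" | "card N = 2"
      using \<open>card N \<le> 2\<close> by linarith
    then show ?thesis
    proof cases
      case 1
      then have "N = {}" unfolding N_def by simp
      then show ?thesis using n by blast
    next
      case 2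
      then obtain i where "N = {i}" by (rule card_1_singletonE)
      then show ?thesis unfolding N_def by blast
    next
      case 3
      then obtain i1 i2 where "N = {i1, i2}" by (auto simp: card_2_iff)
      then show ?thesis unfolding N_def by blast
    qed
  qed
  then obtain i1 i2 where i: "i1 < n" "i2 < n" "N \<subseteq> {i1, i2}"
    by blast
  have split: "\<exists>w\<in>carrier_vec n. \<exists>x y. v = C *\<^sub>v w + (x \<cdot>\<^sub>v unit_vec n i1 + y \<cdot>\<^sub>v unit_vec n i2)"
    if v: "v \<in> carrier_vec n" for v
  proof -
    \<comment> \<open>For a pivot row \<open>i\<close>, column \<open>piv i\<close> of the reduced
      form is the unit vector of index \<open>i\<close>. Placing \<open>v $ i\<close> at position
      \<open>piv i\<close> therefore matches \<open>v\<close> on all pivot rows.\<close>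
    define w where "w = vec n (\<lambda>j. \<Sum>i\<in>{i\<in>R. piv i = j}. v $ i)"
    have w: "w \<in> carrier_vec n"
      unfolding w_def by simp
    have Cw: "(C *\<^sub>v w) $ k = (if k \<in> R then v $ k else 0)" if k: "k < n" for k
    proof -
      have fin: "finite R" unfolding R_def by simp
      have "(C *\<^sub>v w) $ k = (\<Sum>j\<in>{0..<n}. C $$ (k, j) * w $ j)"
        using C w k by (simp add: scalar_prod_def)
      also have "\<dots> = (\<Sum>j\<in>{0..<n}. \<Sum>i\<in>{i\<in>R. piv i = j}. C $$ (k, piv i) * v $ i)"
        unfolding w_def by (intro sum.cong refl) (simp add: sum_distrib_left)
      also have "\<dots> = (\<Sum>i\<in>R. C $$ (k, piv i) * v $ i)"
        using pivD(1) by (intro sum.group fin) (auto simp: R_def le_neq_implies_less)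
      also have "\<dots> = (\<Sum>i\<in>R. if i = k then v $ k else 0)"
      proof (intro sum.cong refl)
        fix i assume "i \<in> R"
        then have "i < n" "piv i < n"
          using pivD(1)[of i] unfolding R_def by auto
        then show "C $$ (k, piv i) * v $ i = (if i = k then v $ k else 0)"
          using pivD(4)[of i] pivD(5)[of i k] k by auto
      qed
      also have "\<dots> = (if k \<in> R then v $ k else 0)"
        using fin by simp
      finally show ?thesis .
    qed
    \<comment> \<open>Pivot rows are already matched, and for \<open>i1 = i2\<close> the coordinate
      must be counted only once.\<close>
    define x y where "x = (if i1 \<in> R then 0 else v $ i1)"
      and "y = (if i2 \<in> R \<or> i1 = i2 then 0 else v $ i2)"
    have "v = C *\<^sub>v w + (x \<cdot>\<^sub>v unit_vec n i1 + y \<cdot>\<^sub>v unit_vec n i2)"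
    proof (rule eq_vecI)
      fix k assume "k < dim_vec (C *\<^sub>v w + (x \<cdot>\<^sub>v unit_vec n i1 + y \<cdot>\<^sub>v unit_vec n i2))"
      then have k: "k < n" by simp
      have "k \<in> R \<or> k = i1 \<or> k = i2"
        using k i(3) unfolding R_def N_def by auto
      then show "v $ k = (C *\<^sub>v w + (x \<cdot>\<^sub>v unit_vec n i1 + y \<cdot>\<^sub>v unit_vec n i2)) $ k"
        using k C Cw[OF k] i(1,2) unfolding x_def y_def by auto
    qed (use v in simp)
    then show ?thesis
      using w by blast
  qed
  have "\<exists>w\<in>carrier_vec n. \<exists>x y. v = A *\<^sub>v w + (x \<cdot>\<^sub>v (Q *\<^sub>v unit_vec n i1) + y \<cdot>\<^sub>v (Q *\<^sub>v unit_vec n i2))"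
    if v: "v \<in> carrier_vec n" for v
  proof -
    have Pv: "P *\<^sub>v v \<in> carrier_vec n"
      using PQ(2) v by (rule mult_mat_vec_carrier)
    obtain w x y where w: "w \<in> carrier_vec n"
      "P *\<^sub>v v = C *\<^sub>v w + (x \<cdot>\<^sub>v unit_vec n i1 + y \<cdot>\<^sub>v unit_vec n i2)"
      using split[OF Pv] by blast
    have QC: "Q * C = A"
      unfolding PQ(1) using assoc_mult_mat[OF PQ(3,2) A] PQ(5) A by simp
    have "v = Q *\<^sub>v (P *\<^sub>v v)"
      using assoc_mult_mat_vec[OF PQ(3,2) v] PQ(5) v by simp
    also have "\<dots> = Q *\<^sub>v (C *\<^sub>v w) + Q *\<^sub>v (x \<cdot>\<^sub>v unit_vec n i1 + y \<cdot>\<^sub>v unit_vec n i2)"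
      unfolding w(2) using C w(1) by (intro mult_add_distrib_mat_vec[OF PQ(3)]) auto
    also have "Q *\<^sub>v (C *\<^sub>v w) = A *\<^sub>v w"
      using QC assoc_mult_mat_vec[OF PQ(3) C w(1)] by simp
    also have "Q *\<^sub>v (x \<cdot>\<^sub>v unit_vec n i1 + y \<cdot>\<^sub>v unit_vec n i2)
        = x \<cdot>\<^sub>v (Q *\<^sub>v unit_vec n i1) + y \<cdot>\<^sub>v (Q *\<^sub>v unit_vec n i2)"
      by (subst mult_add_distrib_mat_vec[OF PQ(3)]) (auto simp: mult_mat_vec[OF PQ(3)])
    finally show ?thesis
      using w(1) by blast
  qed
  then show ?thesis
    using PQ(3) by (intro bexI[of _ "Q *\<^sub>v unit_vec n i1"] bexI[of _ "Q *\<^sub>v unit_vec n i2"])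
      (auto intro: mult_mat_vec_carrier)
qed

section \<open>Polynomials in a matrix acting on vectors, evaluated by Horner's rule\<close>

definition poly_act :: "'a::comm_ring_1 mat \<Rightarrow> 'a poly \<Rightarrow> 'a vec \<Rightarrow> 'a vec" where
  "poly_act A p v = fold_coeffs (\<lambda>c w. c \<cdot>\<^sub>v v + A *\<^sub>v w) p (0\<^sub>v (dim_row A))"

context
  fixes A :: "'a::field mat" and n :: nat
  assumes A: "A \<in> carrier_mat n n"
begin

lemma poly_act_0 [simp]: "poly_act A 0 v = 0\<^sub>v n"
  using A unfolding poly_act_def by simp

lemma poly_act_pCons:
  assumes "v \<in> carrier_vec n"
  shows "poly_act A (pCons c p) v = c \<cdot>\<^sub>v v + A *\<^sub>v poly_act A p v"
proof (cases "c = 0 \<and> p = 0")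
  case True
  moreover have "0 \<cdot>\<^sub>v v + A *\<^sub>v 0\<^sub>v n = 0\<^sub>v n"
    using A assms by (intro eq_vecI) auto
  ultimately show ?thesis by simp
next
  case False
  then show ?thesis
    unfolding poly_act_def by (cases "p = 0") simp_all
qed

lemma poly_act_carrier [simp]: "v \<in> carrier_vec n \<Longrightarrow> poly_act A p v \<in> carrier_vec n"
proof (induction p)
  case (pCons c p)
  then show ?case
    using A by (simp add: poly_act_pCons mult_mat_vec_carrier[OF A])
qed simp

lemma poly_act_add:
  assumes v: "v \<in> carrier_vec n"
  shows "poly_act A (p + q) v = poly_act A p v + poly_act A q v"
proof (induction p q rule: poly_induct2)
  case 0
  then show ?case by simp
next
  case (pCons c p d q)
  define x y where "x = A *\<^sub>v poly_act A p v" and "y = A *\<^sub>v poly_act A q v"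
  have xy: "x \<in> carrier_vec n" "y \<in> carrier_vec n"
    unfolding x_def y_def using v by (auto intro: mult_mat_vec_carrier[OF A])
  have "A *\<^sub>v (poly_act A p v + poly_act A q v) = x + y"
    unfolding x_def y_def using v by (simp add: mult_add_distrib_mat_vec[OF A])
  then have "poly_act A (pCons c p + pCons d q) v = (c + d) \<cdot>\<^sub>v v + (x + y)"
    using pCons.IH v by (simp add: poly_act_pCons)
  also have "\<dots> = (c \<cdot>\<^sub>v v + x) + (d \<cdot>\<^sub>v v + y)"
    using v xy by (intro eq_vecI) (auto simp: algebra_simps)
  finally show ?case
    using v unfolding x_def y_def by (simp add: poly_act_pCons)
qed

lemma poly_act_add_vec:
  assumes v: "v \<in> carrier_vec n" "w \<in> carrier_vec n"
  shows "poly_act A p (v + w) = poly_act A p v + poly_act A p w"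
proof (induction p)
  case (pCons c p)
  define x y where "x = A *\<^sub>v poly_act A p v" and "y = A *\<^sub>v poly_act A p w"
  have xy: "x \<in> carrier_vec n" "y \<in> carrier_vec n"
    unfolding x_def y_def using v by (auto intro: mult_mat_vec_carrier[OF A])
  have "A *\<^sub>v (poly_act A p v + poly_act A p w) = x + y"
    unfolding x_def y_def using v by (simp add: mult_add_distrib_mat_vec[OF A])
  then have "poly_act A (pCons c p) (v + w) = c \<cdot>\<^sub>v (v + w) + (x + y)"
    using pCons.IH v by (simp add: poly_act_pCons)
  also have "\<dots> = (c \<cdot>\<^sub>v v + x) + (c \<cdot>\<^sub>v w + y)"
    using v xy by (intro eq_vecI) (auto simp: algebra_simps)
  finally show ?case
    using v unfolding x_def y_def by (simp add: poly_act_pCons)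
qed simp

lemma poly_act_smult:
  assumes v: "v \<in> carrier_vec n"
  shows "poly_act A (smult c p) v = c \<cdot>\<^sub>v poly_act A p v"
proof (induction p)
  case 0
  then show ?case by (intro eq_vecI) auto
next
  case (pCons d p)
  then show ?case
    using v A by (simp add: poly_act_pCons mult_mat_vec[OF A] smult_add_distrib_vec[of _ n] smult_smult_assoc
        mult_mat_vec_carrier[OF A])
qed

lemma poly_act_polyX_mult:
  assumes v: "v \<in> carrier_vec n"
  shows "poly_act A (polyX * p) v = A *\<^sub>v poly_act A p v"
proof -
  have "polyX * p = pCons 0 p"
    unfolding polyX_def by simp
  moreover have "0 \<cdot>\<^sub>v v + A *\<^sub>v poly_act A p v = A *\<^sub>v poly_act A p v"
    using A v by (intro eq_vecI) auto
  ultimately show ?thesis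
    using v by (simp add: poly_act_pCons)
qed

lemma poly_act_1: "v \<in> carrier_vec n \<Longrightarrow> poly_act A 1 v = v"
  using A unfolding one_pCons by (simp add: poly_act_pCons) (intro eq_vecI; simp)

lemma poly_act_mult:
  assumes v: "v \<in> carrier_vec n"
  shows "poly_act A (p * q) v = poly_act A p (poly_act A q v)"
proof (induction p)
  case (pCons c p)
  have "pCons c p * q = smult c q + polyX * (p * q)"
    unfolding polyX_def by simp
  then show ?case
    using pCons.IH v by (simp add: poly_act_add poly_act_smult poly_act_polyX_mult poly_act_pCons)
qed simp

lemma poly_act_polyX_pow:
  "v \<in> carrier_vec n \<Longrightarrow> poly_act A (polyX ^ k) v = A ^\<^sub>m k *\<^sub>v v"
proof (induction k arbitrary: v)
  case 0
  then show ?case using A by (simp add: poly_act_1)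
next
  case (Suc k)
  have Av: "A *\<^sub>v v \<in> carrier_vec n"
    using A Suc.prems by (rule mult_mat_vec_carrier)
  have "poly_act A polyX v = A *\<^sub>v v"
    using poly_act_polyX_mult[OF Suc.prems, of 1] Suc.prems by (simp add: poly_act_1)
  then have "poly_act A (polyX ^ Suc k) v = poly_act A (polyX ^ k) (A *\<^sub>v v)"
    using poly_act_mult[OF Suc.prems, of "polyX ^ k" polyX] by (simp add: mult.commute)
  also have "\<dots> = A ^\<^sub>m k *\<^sub>v (A *\<^sub>v v)"
    by (rule Suc.IH[OF Av])
  also have "\<dots> = A ^\<^sub>m Suc k *\<^sub>v v"
    using assoc_mult_mat_vec[OF pow_carrier_mat[OF A] A Suc.prems] by simp
  finally show ?case .
qed

end

text \<open>Nakayama's argument: substituting the decomposition \<open>v = A w + x e + y f\<close>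
  into itself \<open>k\<close> times leaves a remainder in the image of \<open>A ^ k\<close>, which
  is 0 for suitable \<open>k\<close>.\<close>

lemma nilpotent_two_generators:
  fixes A :: "'a::field mat"
  assumes A: "A \<in> carrier_mat n n" and nil: "nilpotent_mat A" and ker: "kernel_dim A \<le> 2" and n: "0 < n"
  obtains e f where "e \<in> carrier_vec n" "f \<in> carrier_vec n"
    "\<And>v. v \<in> carrier_vec n \<Longrightarrow> \<exists>p q. v = poly_act A p e + poly_act A q f"
proof -
  obtain e f where ef: "e \<in> carrier_vec n" "f \<in> carrier_vec n"
    and cogen: "\<And>v. v \<in> carrier_vec n \<Longrightarrow> \<exists>w\<in>carrier_vec n. \<exists>x y. v = A *\<^sub>v w + (x \<cdot>\<^sub>v e + y \<cdot>\<^sub>v f)"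
    using kernel_dim_le_2_imp_two_cogenerators[OF A n ker] by blast
  have gen: "\<exists>w\<in>carrier_vec n. \<exists>p q. v = poly_act A (polyX ^ k) w + (poly_act A p e + poly_act A q f)"
    if v: "v \<in> carrier_vec n" for v k
  proof (induction k)
    case 0
    have "v = poly_act A (polyX ^ 0) v + (poly_act A 0 e + poly_act A 0 f)"
      using v by (simp add: poly_act_1[OF A] poly_act_0[OF A])
    then show ?case
      using v by blast
  next
    case (Suc k)
    then obtain w p q where w: "w \<in> carrier_vec n"
      "v = poly_act A (polyX ^ k) w + (poly_act A p e + poly_act A q f)"
      by blast
    obtain u x y where u: "u \<in> carrier_vec n" "w = A *\<^sub>v u + (x \<cdot>\<^sub>v e + y \<cdot>\<^sub>v f)"
      using cogen[OF w(1)] by blast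
    have w_eq: "w = poly_act A polyX u + (poly_act A [:x:] e + poly_act A [:y:] f)"
      using poly_act_polyX_mult[OF A u(1), of 1] poly_act_smult[OF A ef(1), of x 1]
        poly_act_smult[OF A ef(2), of y 1] u ef by (simp add: poly_act_1[OF A])
    have "poly_act A (polyX ^ k) w = poly_act A (polyX ^ Suc k) u
        + (poly_act A (polyX ^ k * [:x:]) e + poly_act A (polyX ^ k * [:y:]) f)"
      unfolding w_eq using u(1) ef
      by (simp add: poly_act_add_vec[OF A] poly_act_carrier[OF A] poly_act_mult[OF A, symmetric]
          mult.commute[of polyX] del: mult_pCons_right)
    then have "v = poly_act A (polyX ^ Suc k) u
        + (poly_act A (polyX ^ k * [:x:] + p) e + poly_act A (polyX ^ k * [:y:] + q) f)"
      unfolding w(2) poly_act_add[OF A ef(1)] poly_act_add[OF A ef(2)]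
      using u(1) ef by (intro eq_vecI) (auto simp: carrier_vecD[OF poly_act_carrier[OF A]])
    then show ?case
      using u(1) by blast
  qed
  obtain k where k: "A ^\<^sub>m k = 0\<^sub>m n n"
    using nil A unfolding nilpotent_mat_def by auto
  have "\<exists>p q. v = poly_act A p e + poly_act A q f" if v: "v \<in> carrier_vec n" for v
  proof -
    obtain w p q where w: "w \<in> carrier_vec n"
      "v = poly_act A (polyX ^ k) w + (poly_act A p e + poly_act A q f)"
      using gen[OF v] by blast
    have "poly_act A (polyX ^ k) w = 0\<^sub>v n"
      using w(1) by (simp add: poly_act_polyX_pow[OF A] k zero_mat_mult_vec)
    then show ?thesis
      using w(2) ef by (auto simp: poly_act_carrier[OF A])
  qed
  then show ?thesis
    using that ef by blast
qed

text \<open>\<open>e\<close> is a generator of maximal order \<open>a\<close>; the other generator is corrected by a multiple of \<open>e\<close> so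
  that its order \<open>b\<close> becomes equal to its order modulo the submodule generated by \<open>e\<close>.\<close>

lemma two_block_exists:
  fixes A :: "'a::alg_closed_field mat"
  assumes A: "A \<in> carrier_mat n n" and nil: "nilpotent_mat A" and ker: "kernel_dim A \<le> 2" and n: "0 < n"
  shows "\<exists>a b d \<psi>. two_block A n a b d \<psi>"
proof -
  define act where "act = poly_act A"
  note act_carrier [simp] = poly_act_carrier[OF A, folded act_def]
  note act_0 [simp] = poly_act_0[OF A, folded act_def]
  note act_1 = poly_act_1[OF A, folded act_def]
  note act_add = poly_act_add[OF A, folded act_def]
  note act_add_vec = poly_act_add_vec[OF A, folded act_def]
  note act_smult = poly_act_smult[OF A, folded act_def]
  note act_mult = poly_act_mult[OF A, folded act_def]
  note act_pow = poly_act_polyX_pow[OF A, folded act_def]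
  have act_zero_vec: "act p (0\<^sub>v n) = 0\<^sub>v n" for p
    using act_mult[of "0\<^sub>v n" p 0] by simp
  obtain a where a: "A ^\<^sub>m a = 0\<^sub>m n n" "\<And>k. k < a \<Longrightarrow> A ^\<^sub>m k \<noteq> 0\<^sub>m n n"
  proof -
    have "\<exists>k. A ^\<^sub>m k = 0\<^sub>m n n"
      using nil A unfolding nilpotent_mat_def by auto
    then show ?thesis
      using that[of "LEAST k. A ^\<^sub>m k = 0\<^sub>m n n"] LeastI_ex[of "\<lambda>k. A ^\<^sub>m k = 0\<^sub>m n n"] not_less_Least
      by blast
  qed
  have "a \<noteq> 0"
  proof
    assume "a = 0"
    then have "1\<^sub>m n = (0\<^sub>m n n :: 'a mat)"
      using a(1) A by simp
    then have "(1\<^sub>m n :: 'a mat) $$ (0, 0) = 0\<^sub>m n n $$ (0, 0)"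
      by simp
    then show False
      using n by simp
  qed
  then have a_pos: "0 < a" by simp
  have act_a: "act (polyX ^ a * p) v = 0\<^sub>v n" if "v \<in> carrier_vec n" for p v
    using that by (simp add: act_mult act_pow a(1) zero_mat_mult_vec)
  have act_a_dvd: "act p v = 0\<^sub>v n" if "v \<in> carrier_vec n" "polyX ^ a dvd p" for p v
    using that act_a by (auto elim!: dvdE)
  obtain e f where ef: "e \<in> carrier_vec n" "f \<in> carrier_vec n"
    and gen: "\<And>v. v \<in> carrier_vec n \<Longrightarrow> \<exists>p q. v = act p e + act q f"
    and e_order: "act (polyX ^ (a - 1)) e \<noteq> 0\<^sub>v n"
  proof -
    obtain e f where ef: "e \<in> carrier_vec n" "f \<in> carrier_vec n"
      and gen: "\<And>v. v \<in> carrier_vec n \<Longrightarrow> \<exists>p q. v = act p e + act q f"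
      using nilpotent_two_generators[OF A nil ker n] unfolding act_def by metis
    \<comment> \<open>If \<open>A ^ (a - 1)\<close> killed both generators it would be 0, against
      the minimality of \<open>a\<close>. A generator that survives is named
      \<open>e\<close>.\<close>
    have "\<not> (act (polyX ^ (a - 1)) e = 0\<^sub>v n \<and> act (polyX ^ (a - 1)) f = 0\<^sub>v n)"
    proof
      assume zero: "act (polyX ^ (a - 1)) e = 0\<^sub>v n \<and> act (polyX ^ (a - 1)) f = 0\<^sub>v n"
      have "A ^\<^sub>m (a - 1) *\<^sub>v v = 0\<^sub>m n n *\<^sub>v v" if v: "v \<in> carrier_vec n" for v
      proof -
        obtain p q where pq: "v = act p e + act q f"
          using gen[OF v] by blast
        have "act (polyX ^ (a - 1)) (act p w) = act p (act (polyX ^ (a - 1)) w)" if "w \<in> carrier_vec n" for p w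
          using that by (simp add: act_mult[symmetric] mult.commute)
        then have "act (polyX ^ (a - 1)) v = 0\<^sub>v n"
          unfolding pq using ef zero by (simp add: act_add_vec act_zero_vec)
        then show ?thesis
          using v by (simp add: act_pow zero_mat_mult_vec)
      qed
      then have "A ^\<^sub>m (a - 1) = 0\<^sub>m n n"
        using A by (intro mat_eqI_mult_vec) auto
      then show False
        using a(2)[of "a - 1"] a_pos by simp
    qed
    moreover have "\<exists>p q. v = act p f + act q e" if v: "v \<in> carrier_vec n" for v
    proof -
      obtain p q where "v = act p e + act q f"
        using gen[OF v] by blast
      then have "v = act q f + act p e"
        using ef comm_add_vec[of "act p e" n "act q f"] by simp
      then show ?thesis by blast
    qed
    ultimately show ?thesis
      using that[of e f] that[of f e] ef gen by blast
  qed
  \<comment> \<open>A polynomial with nonzero constant term acts invertibly, because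
    \<open>polyX ^ a\<close> acts as zero.\<close>
  have unit_action: "\<exists>g. \<forall>v\<in>carrier_vec n. act (g * (polyX ^ i * u)) v = act (polyX ^ i) v"
    if "poly u 0 \<noteq> 0" for u i
  proof -
    obtain g where "polyX ^ a dvd 1 - g * u"
      using polyX_pow_inverse[OF \<open>poly u 0 \<noteq> 0\<close>] by blast
    then obtain h where h: "1 - g * u = polyX ^ a * h"
      by (rule dvdE)
    have "g * (polyX ^ i * u) + polyX ^ a * (h * polyX ^ i) = polyX ^ i * (g * u + polyX ^ a * h)"
      by (simp add: algebra_simps)
    also have "g * u + polyX ^ a * h = 1"
      unfolding h[symmetric] by simp
    finally have "g * (polyX ^ i * u) + polyX ^ a * (h * polyX ^ i) = polyX ^ i"
      by simp
    then have "act (polyX ^ i) v = act (g * (polyX ^ i * u)) v" if "v \<in> carrier_vec n" for v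
      using that act_add[OF that, of "g * (polyX ^ i * u)" "polyX ^ a * (h * polyX ^ i)"] act_a[OF that] by simp
    then show ?thesis by metis
  qed
  have factor: "\<exists>i u. p = polyX ^ i * u \<and> i \<le> k \<and> (i < k \<longrightarrow> poly u 0 \<noteq> 0)" for p :: "'a poly" and k
  proof -
    obtain i where i: "i \<le> k" "polyX ^ i dvd p" "i < k \<Longrightarrow> \<not> polyX ^ Suc i dvd p"
      using maximal_nat_between[of "\<lambda>i. polyX ^ i dvd p" 0 k] by auto
    obtain u where u: "p = polyX ^ i * u"
      using i(2) by (rule dvdE)
    have "poly u 0 \<noteq> 0" if "i < k"
      using i(3)[OF that] unfolding u polyX_dvd_iff[symmetric] by (simp add: mult.commute[of polyX])
    then show ?thesis
      using i(1) u by blast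
  qed
  have e_zero_iff: "act p e = 0\<^sub>v n \<longleftrightarrow> polyX ^ a dvd p" for p
  proof
    assume zero: "act p e = 0\<^sub>v n"
    obtain i u where i: "p = polyX ^ i * u" "i \<le> a" "i < a \<longrightarrow> poly u 0 \<noteq> 0"
      using factor by blast
    show "polyX ^ a dvd p"
    proof (cases "i < a")
      case True
      then obtain g where "act (g * p) e = act (polyX ^ i) e"
        using unit_action i ef(1) by blast
      then have "act (polyX ^ i) e = 0\<^sub>v n"
        using ef(1) zero by (simp add: act_mult act_zero_vec)
      then have "act (polyX ^ (a - 1 - i) * polyX ^ i) e = 0\<^sub>v n"
        using ef(1) by (simp add: act_mult act_zero_vec)
      then show ?thesis
        using e_order True by (simp add: power_add[symmetric])
    next
      case False
      then show ?thesis
        using i by simp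
    qed
  qed (use act_a_dvd ef in blast)
  \<comment> \<open>The order of \<open>f\<close> modulo the submodule generated by
    \<open>e\<close>.\<close>
  define b where "b = (LEAST k. \<exists>g. act (polyX ^ k) f = act g e)"
  have ex_a: "\<exists>g. act (polyX ^ a) f = act g e"
    using act_a[OF ef(2), of 1] by (intro exI[of _ 0]) simp
  have b_le: "b \<le> a"
    unfolding b_def using ex_a by (rule Least_le)
  have "\<exists>g. act (polyX ^ b) f = act g e"
    unfolding b_def using ex_a by (rule LeastI)
  then obtain g where g: "act (polyX ^ b) f = act g e"
    by blast
  have b_least: "act (polyX ^ k) f \<noteq> act h e" if "k < b" for k h
    using not_less_Least that unfolding b_def by blast
  define d where "d = a - b"
  have a_eq: "a = b + d"
    unfolding d_def using b_le by simp
  \<comment> \<open>Since \<open>polyX ^ a\<close> kills \<open>f\<close>, the order of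
    \<open>e\<close> forces \<open>polyX ^ b\<close> to divide \<open>g\<close>; subtracting the
    quotient times \<open>e\<close> from \<open>f\<close> gives a generator killed by
    \<open>polyX ^ b\<close>.\<close>
  have "act (polyX ^ d * g) e = act (polyX ^ d * polyX ^ b) f"
    using ef g by (simp only: act_mult)
  also have "\<dots> = 0\<^sub>v n"
    using act_a[OF ef(2), of 1] unfolding a_eq by (simp add: power_add mult.commute)
  finally have "polyX ^ (d + b) dvd polyX ^ d * g"
    unfolding e_zero_iff a_eq by (simp add: add.commute)
  then obtain g' where g': "g = polyX ^ b * g'"
    unfolding polyX_pow_add_dvd_iff by (rule dvdE)
  define f' where "f' = f + act (- g') e"
  have f': "f' \<in> carrier_vec n"
    unfolding f'_def using ef by simp
  have act_f': "act p f' = act p f + act (- (p * g')) e" for p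
    unfolding f'_def using ef by (simp add: act_add_vec act_mult[symmetric])
  have cancel: "act p e + act (- p) e = 0\<^sub>v n" for p
    using act_add[OF ef(1), of p "- p"] by simp
  have act_f: "act q f = act q f' + act (q * g') e" for q
  proof -
    have "act q f' + act (q * g') e = act q f + (act (q * g') e + act (- (q * g')) e)"
      unfolding act_f' using ef by (intro eq_vecI) (auto simp: carrier_vecD[OF act_carrier])
    then show ?thesis
      unfolding cancel using ef by simp
  qed
  have f'_b: "act (polyX ^ b) f' = 0\<^sub>v n"
    unfolding act_f' g g' by (rule cancel)
  define \<psi> where "\<psi> p q = act p e + act q f'" for p q
  have psi_zero_iff: "\<psi> p q = 0\<^sub>v n \<longleftrightarrow> polyX ^ a dvd p \<and> polyX ^ b dvd q" for p q
  proof
    have act_b: "act q f' = 0\<^sub>v n" if q: "polyX ^ b dvd q" for q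
    proof -
      obtain h where h: "q = polyX ^ b * h"
        using q by (rule dvdE)
      have "act (h * polyX ^ b) f' = 0\<^sub>v n"
        using f' f'_b by (simp add: act_mult act_zero_vec)
      then show ?thesis
        unfolding h by (simp only: mult.commute)
    qed
    show "\<psi> p q = 0\<^sub>v n" if "polyX ^ a dvd p \<and> polyX ^ b dvd q"
      unfolding \<psi>_def using that act_b[of q] iffD2[OF e_zero_iff[of p]] by simp
    assume zero: "\<psi> p q = 0\<^sub>v n"
    obtain i u where i: "q = polyX ^ i * u" "i \<le> b" "i < b \<longrightarrow> poly u 0 \<noteq> 0"
      using factor by blast
    \<comment> \<open>Otherwise the relation would express \<open>polyX ^ i\<close> times
      \<open>f\<close> as a multiple of \<open>e\<close>, against the choice of
      \<open>b\<close>.\<close>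
    have "\<not> i < b"
    proof
      assume less: "i < b"
      then obtain h where h: "act (h * q) f' = act (polyX ^ i) f'"
        using unit_action i f' by blast
      have "act h (\<psi> p q) = act (h * p) e + act (polyX ^ i) f'"
        unfolding \<psi>_def h[symmetric] using ef f' by (simp add: act_add_vec act_mult)
      then have "act (h * p) e + act (polyX ^ i) f' = 0\<^sub>v n"
        unfolding zero by (simp add: act_zero_vec)
      have "act (polyX ^ i) f = act (polyX ^ i * g') e + act (polyX ^ i) f'"
        unfolding act_f[of "polyX ^ i"] using ef f' by (intro comm_add_vec[of _ n]) simp_all
      also have "\<dots> = act (polyX ^ i * g' - h * p) e + (act (h * p) e + act (polyX ^ i) f')"
        using act_add[OF ef(1), of "polyX ^ i * g' - h * p" "h * p"] ef f'
        by (simp add: assoc_add_vec[of _ n])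
      also have "\<dots> = act (polyX ^ i * g' - h * p) e"
        unfolding \<open>act (h * p) e + act (polyX ^ i) f' = 0\<^sub>v n\<close> using ef by simp
      finally show False
        using b_least[OF less] by blast
    qed
    then have q: "polyX ^ b dvd q"
      using i by simp
    then have "act p e = 0\<^sub>v n"
      using zero act_b[OF q] ef unfolding \<psi>_def by simp
    then show "polyX ^ a dvd p \<and> polyX ^ b dvd q"
      using q e_zero_iff by blast
  qed
  have "two_block A n a b d \<psi>"
  proof
    show "\<psi> p q \<in> carrier_vec n" for p q
      unfolding \<psi>_def using ef f' by simp
    show "\<psi> (p + p') (q + q') = \<psi> p q + \<psi> p' q'" for p p' q q'
      unfolding \<psi>_def act_add[OF ef(1)] act_add[OF f']
      using ef f' by (intro eq_vecI) (auto simp: carrier_vecD[OF act_carrier])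
    show "\<psi> (smult c p) (smult c q) = c \<cdot>\<^sub>v \<psi> p q" for c p q
      unfolding \<psi>_def using ef f' by (simp add: act_smult smult_add_distrib_vec[of _ n])
    show "\<exists>p q. v = \<psi> p q" if v: "v \<in> carrier_vec n" for v
    proof -
      obtain p q where "v = act p e + act q f"
        using gen[OF v] by blast
      also have "\<dots> = \<psi> (p + q * g') q"
        unfolding \<psi>_def act_f[of q] act_add[OF ef(1)]
        using ef f' by (intro eq_vecI) (auto simp: carrier_vecD[OF act_carrier])
      finally show ?thesis by blast
    qed
    show "A *\<^sub>v \<psi> p q = \<psi> (polyX * p) (polyX * q)" for p q
      unfolding \<psi>_def act_def poly_act_polyX_mult[OF A ef(1)] poly_act_polyX_mult[OF A f']
      using ef f' by (intro mult_add_distrib_mat_vec[OF A]) (auto simp: poly_act_carrier[OF A])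
  qed (use A a_eq a_pos psi_zero_iff in auto)
  then show ?thesis by blast
qed

theorem theorem17:
  fixes A :: "'a::alg_closed_field mat" and n :: nat
  assumes "A \<in> carrier_mat n n"
    and "nilpotent_mat A"
    and "regular_mat 2 A"
  shows "irreducible_space (subtopology (zariski_mat_pair n) (N2 n A))"
proof (cases "n = 0")
  case True
  \<comment> \<open>For \<open>n = 0\<close> the variety is a single point. This case is separate
    because a two-block presentation has \<open>a > 0\<close> and hence a nonzero space.\<close>
  have "N2 n A \<subseteq> {(0\<^sub>m 0 0, 0\<^sub>m 0 0)}"
    unfolding N2_def True by auto
  moreover have "(0\<^sub>m 0 0, 0\<^sub>m 0 0) \<in> N2 n A"
    using assms(1) unfolding N2_def True nilpotent_mat_def by (auto intro: exI[of _ 1])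
  ultimately have "N2 n A = {(0\<^sub>m 0 0, 0\<^sub>m 0 0)}"
    by blast
  then show ?thesis
    unfolding zariski_mat_pair_def using True by (intro irreducible_space_zariskiI) auto
next
  case False
  have "char_matrix A 0 = A"
    using assms(1) unfolding char_matrix_def by (intro eq_matI) auto
  then have "kernel_dim A \<le> 2"
    using assms(3) unfolding regular_mat_def by metis
  then obtain a b d \<psi> where "two_block A n a b d \<psi>"
    using two_block_exists[OF assms(1,2)] False by blast
  then show ?thesis
    by (rule two_block.irreducible_N2)
qed

end
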